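(* Let $K$ be a field and $E$ an arbitrary graph, and let $\sigma=(\sigma_0,\sigma_1)$ be an automorphism of $E$, with induced graded algebra automorphism of the Leavitt path algebra $L_K(E)$ also denoted by $\sigma$. Then $$L_K(E)^{\sigma}\cong L_K(E_{\sigma})$$ as $\mathbb Z$-graded $K$-algebras. In particular, if $E^0$ is finite, then the isomorphism is unital.
   Context: A graph $E=(E^0,E^1,s,r)$ consists of disjoint sets $E^0$ (vertices) and $E^1$ (edges), of arbitrary cardinality, and maps $s,r\colon E^1\to E^0$ (source and range). A regular vertex is $v\in E^0$ with $0<|s^{-1}(v)|<\infty$. An automorphism of $E$ is a pair $\sigma=(\sigma_0,\sigma_1)$ of bijections $\sigma_0\colon E^0\to E^0$, $\sigma_1\colon E^1\to E^1$ with $s\circ\sigma_1=\sigma_0\circ s$ and $r\circ\sigma_1=\sigma_0\circ r$. The twisted graph is $E_\sigma=(E^0,E^1,s,r_\sigma)$ with $r_\sigma=\sigma_0^{-1}\circ r=r\circ\sigma_1^{-1}$ (same vertices, edges and source map as $E$). The Leavitt path algebra $L_K(E)$ is the (not necessarily unital) associative $K$-algebra generated by $E^0\cup E^1\cup\{e^*\mid e\in E^1\}$ subject to, for all $v,w\in E^0$, $e,f\in E^1$: (1) $vw=\delta_{v,w}w$; (2) $s(e)e=e=er(e)$ and $e^*s(e)=e^*=r(e)e^*$; (3) $e^*f=\delta_{e,f}r(e)$; (4) $v=\sum_{e\in s^{-1}(v)}ee^*$ for every regular vertex $v$. It is $\mathbb Z$-graded by $\deg v=0$, $\deg e=1$,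 $\deg e^*=-1$. If $E^0$ is finite, its identity is $\sum_{v\in E^0}v$. The automorphism $\sigma$ of $E$ induces the graded $K$-algebra automorphism of $L_K(E)$ given by $v\mapsto\sigma_0(v)$, $e\mapsto\sigma_1(e)$, $e^*\mapsto\sigma_1(e)^*$. Zhang twist by a graded automorphism: if $A=\bigoplus_{n\in\mathbb Z}A_n$ is a $\mathbb Z$-graded $K$-algebra and $\sigma$ a graded $K$-algebra automorphism of $A$, then $A^\sigma$ is the graded $K$-algebra with the same underlying graded $K$-vector space as $A$ and multiplication $a\star b=a\,\sigma^m(b)$ for $a\in A_m$, $b\in A$ ($m\in\mathbb Z$). *)

theory Defs
  imports
    "HOL-Library.Poly_Mapping"
    "HOL-Algebra.Module"
    "HOL-Algebra.Algebraic_Closure_Type"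
    "Graph_Theory.Digraph"
begin

section \<open>Graded algebras without identity\<close>

text \<open>
  The field of scalars is a type of class \<^class>\<open>field\<close>; algebras are carrier-based, because
  Leavitt path algebras are quotients depending on a graph.  The field \<open>one\<close> that
  the record type \<open>module\<close> inherits from \<open>ring\<close> is not part of the structure of
  a graded algebra: neither \<open>graded_algebra\<close> nor \<open>graded_algebra_iso\<close> refers to it.
\<close>

record ('k, 'a) graded_alg = "('k, 'a) module" +
  homog :: "int \<Rightarrow> 'a set"

definition homog_decomp ::
    "('k, 'a, 'm) graded_alg_scheme \<Rightarrow> 'a \<Rightarrow> (int \<Rightarrow> 'a) \<Rightarrow> bool" where
  "homog_decomp A a f \<longleftrightarrow>
     (\<forall>n. f n \<in> homog A n) \<and> finite {n. f n \<noteq> \<zero>\<^bsub>A\<^esub>} \<and>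
     a = finsum A f {n. f n \<noteq> \<zero>\<^bsub>A\<^esub>}"

locale graded_algebra =
  module "ring_of_type_algebra :: 'k ring" A
  for A :: "('k::field, 'a, 'm) graded_alg_scheme" (structure) +
  assumes mult_closed: "\<lbrakk>x \<in> carrier A; y \<in> carrier A\<rbrakk> \<Longrightarrow> x \<otimes> y \<in> carrier A"
    and mult_assoc: "\<lbrakk>x \<in> carrier A; y \<in> carrier A; z \<in> carrier A\<rbrakk> \<Longrightarrow>
      (x \<otimes> y) \<otimes> z = x \<otimes> (y \<otimes> z)"
    and mult_add_left: "\<lbrakk>x \<in> carrier A; y \<in> carrier A; z \<in> carrier A\<rbrakk> \<Longrightarrow>
      (x \<oplus> y) \<otimes> z = x \<otimes> z \<oplus> y \<otimes> z"
    and mult_add_right: "\<lbrakk>x \<in> carrier A; y \<in> carrier A; z \<in> carrier A\<rbrakk> \<Longrightarrow>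
      z \<otimes> (x \<oplus> y) = z \<otimes> x \<oplus> z \<otimes> y"
    and mult_smult_left: "\<lbrakk>x \<in> carrier A; y \<in> carrier A\<rbrakk> \<Longrightarrow>
      (c \<odot> x) \<otimes> y = c \<odot> (x \<otimes> y)"
    and mult_smult_right: "\<lbrakk>x \<in> carrier A; y \<in> carrier A\<rbrakk> \<Longrightarrow>
      x \<otimes> (c \<odot> y) = c \<odot> (x \<otimes> y)"
    and homog_submodule: "submodule (homog A n) (ring_of_type_algebra :: 'k ring) A"
    and homog_direct_sum: "a \<in> carrier A \<Longrightarrow> \<exists>!f. homog_decomp A a f"
    and homog_mult: "\<lbrakk>x \<in> homog A m; y \<in> homog A n\<rbrakk> \<Longrightarrow> x \<otimes> y \<in> homog A (m + n)"

definition graded_algebra_iso ::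
    "('k, 'a, 'm) graded_alg_scheme \<Rightarrow> ('k, 'b, 'n) graded_alg_scheme \<Rightarrow> ('a \<Rightarrow> 'b) set" where
  "graded_algebra_iso A B = {\<phi>.
     bij_betw \<phi> (carrier A) (carrier B) \<and>
     (\<forall>x\<in>carrier A. \<forall>y\<in>carrier A. \<phi> (x \<oplus>\<^bsub>A\<^esub> y) = \<phi> x \<oplus>\<^bsub>B\<^esub> \<phi> y) \<and>
     (\<forall>x\<in>carrier A. \<forall>y\<in>carrier A. \<phi> (x \<otimes>\<^bsub>A\<^esub> y) = \<phi> x \<otimes>\<^bsub>B\<^esub> \<phi> y) \<and>
     (\<forall>c. \<forall>x\<in>carrier A. \<phi> (c \<odot>\<^bsub>A\<^esub> x) = c \<odot>\<^bsub>B\<^esub> \<phi> x) \<and>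
     (\<forall>n. \<phi> ` homog A n = homog B n)}"


section \<open>Zhang twist\<close>

definition homog_part :: "('k, 'a, 'm) graded_alg_scheme \<Rightarrow> 'a \<Rightarrow> int \<Rightarrow> 'a" where
  "homog_part A a = (THE f. homog_decomp A a f)"

definition aut_power :: "('k, 'a, 'm) graded_alg_scheme \<Rightarrow> ('a \<Rightarrow> 'a) \<Rightarrow> int \<Rightarrow> 'a \<Rightarrow> 'a" where
  "aut_power A h m =
     (if 0 \<le> m then h ^^ nat m else (inv_into (carrier A) h) ^^ nat (- m))"

text \<open>
  The twisted product is \<open>a \<star> b = a \<cdot> h\<^sup>m(b)\<close> for \<open>a\<close> homogeneous of degree \<open>m\<close>, extended
  additively in \<open>a\<close> along the decomposition of \<open>a\<close> into homogeneous parts.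
\<close>

definition zhang_twist ::
    "('k, 'a) graded_alg \<Rightarrow> ('a \<Rightarrow> 'a) \<Rightarrow> ('k, 'a) graded_alg" where
  "zhang_twist A h = A\<lparr>monoid.mult := (\<lambda>a b.
     finsum A (\<lambda>m. homog_part A a m \<otimes>\<^bsub>A\<^esub> aut_power A h m b)
       {m. homog_part A a m \<noteq> \<zero>\<^bsub>A\<^esub>})\<rparr>"


section \<open>Graph automorphisms and twisted graphs\<close>

text \<open>
  A graph is a \<^locale>\<open>wf_digraph\<close>, with \<open>tail\<close> and \<open>head\<close> as source and range; there is no
  finiteness or countability restriction.
\<close>

definition graph_automorphism ::
    "('v, 'e) pre_digraph \<Rightarrow> ('v \<Rightarrow> 'v) \<Rightarrow> ('e \<Rightarrow> 'e) \<Rightarrow> bool" where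
  "graph_automorphism E \<sigma>\<^sub>0 \<sigma>\<^sub>1 \<longleftrightarrow>
     bij_betw \<sigma>\<^sub>0 (verts E) (verts E) \<and> bij_betw \<sigma>\<^sub>1 (arcs E) (arcs E) \<and>
     (\<forall>e\<in>arcs E. tail E (\<sigma>\<^sub>1 e) = \<sigma>\<^sub>0 (tail E e)) \<and>
     (\<forall>e\<in>arcs E. head E (\<sigma>\<^sub>1 e) = \<sigma>\<^sub>0 (head E e))"

definition twisted_graph ::
    "('v, 'e) pre_digraph \<Rightarrow> ('v \<Rightarrow> 'v) \<Rightarrow> ('v, 'e) pre_digraph" where
  "twisted_graph E \<sigma>\<^sub>0 = E\<lparr>head := (\<lambda>e. inv_into (verts E) \<sigma>\<^sub>0 (head E e))\<rparr>"

definition regular_vertex :: "('v, 'e) pre_digraph \<Rightarrow> 'v \<Rightarrow> bool" where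
  "regular_vertex E v \<longleftrightarrow>
     v \<in> verts E \<and> finite (out_arcs E v) \<and> out_arcs E v \<noteq> {}"


section \<open>The free algebra on vertices, edges and ghost edges\<close>

datatype ('v, 'e) gen = Vertex 'v | Edge 'e | Ghost 'e

datatype 'a word = Word (letters: "'a list")

instantiation word :: (type) monoid_add
begin

definition zero_word :: "'a word" where "0 = Word []"

definition plus_word :: "'a word \<Rightarrow> 'a word \<Rightarrow> 'a word" where
  "u + v = Word (letters u @ letters v)"

instance by standard (simp_all add: zero_word_def plus_word_def)

end

text \<open>
  Since words form a monoid under concatenation, finitely supported \<open>'k\<close>-valued functions on
  words, with the convolution product of \<^theory>\<open>HOL-Library.Poly_Mapping\<close>, are the free
  unital algebra.  The free algebra without identity consists of those that vanish at the empty
  word \<open>0\<close>.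
\<close>

type_synonym ('v, 'e, 'k) free_elem = "('v, 'e) gen word \<Rightarrow>\<^sub>0 'k"

definition gens :: "('v, 'e) pre_digraph \<Rightarrow> ('v, 'e) gen set" where
  "gens E = Vertex ` verts E \<union> Edge ` arcs E \<union> Ghost ` arcs E"

definition free_alg :: "('v, 'e) pre_digraph \<Rightarrow> ('v, 'e, 'k::field) free_elem set" where
  "free_alg E = {x. \<forall>w\<in>Poly_Mapping.keys x. w \<noteq> 0 \<and> set (letters w) \<subseteq> gens E}"

definition scale :: "'k \<Rightarrow> ('v, 'e, 'k::field) free_elem \<Rightarrow> ('v, 'e, 'k) free_elem" where
  "scale c x = Poly_Mapping.single 0 c * x"

definition gen_elem :: "('v, 'e) gen \<Rightarrow> ('v, 'e, 'k::field) free_elem" where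
  "gen_elem g = Poly_Mapping.single (Word [g]) 1"

abbreviation vx :: "'v \<Rightarrow> ('v, 'e, 'k::field) free_elem" where "vx v \<equiv> gen_elem (Vertex v)"
abbreviation ed :: "'e \<Rightarrow> ('v, 'e, 'k::field) free_elem" where "ed e \<equiv> gen_elem (Edge e)"
abbreviation gh :: "'e \<Rightarrow> ('v, 'e, 'k::field) free_elem" where "gh e \<equiv> gen_elem (Ghost e)"

fun gen_degree :: "('v, 'e) gen \<Rightarrow> int" where
  "gen_degree (Vertex v) = 0"
| "gen_degree (Edge e) = 1"
| "gen_degree (Ghost e) = - 1"

definition word_degree :: "('v, 'e) gen word \<Rightarrow> int" where
  "word_degree w = (\<Sum>g\<leftarrow>letters w. gen_degree g)"

definition free_homog :: "('v, 'e) pre_digraph \<Rightarrow> int \<Rightarrow> ('v, 'e, 'k::field) free_elem set" where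
  "free_homog E n = {x \<in> free_alg E. \<forall>w\<in>Poly_Mapping.keys x. word_degree w = n}"


section \<open>Leavitt path algebras\<close>

text \<open>A relation \<open>x = y\<close> is encoded by the element \<open>x - y\<close> of the free algebra.\<close>

definition lpa_relators :: "('v, 'e) pre_digraph \<Rightarrow> ('v, 'e, 'k::field) free_elem set" where
  "lpa_relators E =
     {vx v * vx w - (if v = w then vx w else 0) | v w. v \<in> verts E \<and> w \<in> verts E} \<union>
     {vx (tail E e) * ed e - ed e | e. e \<in> arcs E} \<union>
     {ed e * vx (head E e) - ed e | e. e \<in> arcs E} \<union>
     {gh e * vx (tail E e) - gh e | e. e \<in> arcs E} \<union>
     {vx (head E e) * gh e - gh e | e. e \<in> arcs E} \<union>
     {gh e * ed f - (if e = f then vx (head E e) else 0) | e f. e \<in> arcs E \<and> f \<in> arcs E} \<union>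
     {vx v - (\<Sum>e\<in>out_arcs E v. ed e * gh e) | v. regular_vertex E v}"

inductive_set lpa_ideal :: "('v, 'e) pre_digraph \<Rightarrow> ('v, 'e, 'k::field) free_elem set"
  for E :: "('v, 'e) pre_digraph" where
  relator: "x \<in> lpa_relators E \<Longrightarrow> x \<in> lpa_ideal E"
| zero: "0 \<in> lpa_ideal E"
| add: "\<lbrakk>x \<in> lpa_ideal E; y \<in> lpa_ideal E\<rbrakk> \<Longrightarrow> x + y \<in> lpa_ideal E"
| scale: "x \<in> lpa_ideal E \<Longrightarrow> scale c x \<in> lpa_ideal E"
| mult_left: "\<lbrakk>x \<in> lpa_ideal E; a \<in> free_alg E\<rbrakk> \<Longrightarrow> a * x \<in> lpa_ideal E"
| mult_right: "\<lbrakk>x \<in> lpa_ideal E; a \<in> free_alg E\<rbrakk> \<Longrightarrow> x * a \<in> lpa_ideal E"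

definition lpa_rel ::
    "('v, 'e) pre_digraph \<Rightarrow> (('v, 'e, 'k::field) free_elem \<times> ('v, 'e, 'k) free_elem) set" where
  "lpa_rel E = {(x, y). x \<in> free_alg E \<and> y \<in> free_alg E \<and> x - y \<in> lpa_ideal E}"

definition lpa_class ::
    "('v, 'e) pre_digraph \<Rightarrow> ('v, 'e, 'k::field) free_elem \<Rightarrow> ('v, 'e, 'k) free_elem set" where
  "lpa_class E x = lpa_rel E `` {x}"

text \<open>
  The argument of type \<open>'k itself\<close> selects the field.  The component \<open>one\<close> is the sum of
  all vertices if there are finitely many, and has no meaning otherwise.
\<close>

definition leavitt_path_algebra ::
    "'k itself \<Rightarrow> ('v, 'e) pre_digraph \<Rightarrow> ('k::field, ('v, 'e, 'k) free_elem set) graded_alg" where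
  "leavitt_path_algebra K E =
     \<lparr>carrier = free_alg E // lpa_rel E,
      monoid.mult = (\<lambda>P Q. \<Union>x\<in>P. \<Union>y\<in>Q. lpa_class E (x * y)),
      one = lpa_class E (\<Sum>v\<in>verts E. vx v),
      ring.zero = lpa_class E 0,
      add = (\<lambda>P Q. \<Union>x\<in>P. \<Union>y\<in>Q. lpa_class E (x + y)),
      module.smult = (\<lambda>c P. \<Union>x\<in>P. lpa_class E (scale c x)),
      homog = (\<lambda>n. lpa_class E ` free_homog E n)\<rparr>"

text \<open>
  The algebra automorphism induced by a graph automorphism: in every representative, each
  generator is replaced by its image, that is \<open>v\<close> by \<open>\<sigma>\<^sub>0 v\<close>, \<open>e\<close> by \<open>\<sigma>\<^sub>1 e\<close> and the ghost edge
  of \<open>e\<close> by the ghost edge of \<open>\<sigma>\<^sub>1 e\<close>.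
\<close>

definition free_induced ::
    "('v \<Rightarrow> 'v) \<Rightarrow> ('e \<Rightarrow> 'e) \<Rightarrow> ('v, 'e, 'k::field) free_elem \<Rightarrow> ('v, 'e, 'k) free_elem" where
  "free_induced \<sigma>\<^sub>0 \<sigma>\<^sub>1 x =
     (\<Sum>w\<in>Poly_Mapping.keys x.
        Poly_Mapping.single (map_word (map_gen \<sigma>\<^sub>0 \<sigma>\<^sub>1) w) (Poly_Mapping.lookup x w))"

definition lpa_induced ::
    "('v, 'e) pre_digraph \<Rightarrow> ('v \<Rightarrow> 'v) \<Rightarrow> ('e \<Rightarrow> 'e) \<Rightarrow>
     ('v, 'e, 'k::field) free_elem set \<Rightarrow> ('v, 'e, 'k) free_elem set" where
  "lpa_induced E \<sigma>\<^sub>0 \<sigma>\<^sub>1 P = (\<Union>x\<in>P. lpa_class E (free_induced \<sigma>\<^sub>0 \<sigma>\<^sub>1 x))"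

end

theory Submission
  imports Defs "HOL-Algebra.Bij"
begin

text \<open>
  The isomorphism is visible on words.  In the twist, a product of generators \<open>g\<^sub>1 \<star> g\<^sub>2 \<star> \<dots>\<close> equals
  the ordinary product in which \<open>g\<^sub>i\<close> is replaced by \<open>\<sigma>\<^sup>d(g\<^sub>i)\<close>, where \<open>d\<close> is the degree of
  \<open>g\<^sub>1 \<dots> g\<^sub>i\<^sub>-\<^sub>1\<close>.  The elements \<open>v\<close>, \<open>e\<close> and \<open>\<sigma>\<^sup>-\<^sup>1(e)\<^sup>*\<close> of the twist satisfy the Leavitt relations of
  the twisted graph: for instance \<open>\<sigma>\<^sup>-\<^sup>1(e)\<^sup>* \<star> f = \<sigma>\<^sup>-\<^sup>1(e)\<^sup>* \<sigma>\<^sup>-\<^sup>1(f)\<close> is \<open>r(\<sigma>\<^sup>-\<^sup>1(e))\<close> if \<open>e = f\<close> and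
  \<open>0\<close> otherwise, and \<open>e \<star> \<sigma>\<^sup>-\<^sup>1(e)\<^sup>* = e e\<^sup>*\<close>.

  Instead of invoking a universal property, the proof works with the bijection of the set of words
  that underlies this (\<open>twist_word\<close>), extended linearly to the free algebra (\<open>twist\<close>).  It carries
  the Leavitt ideal of the twisted graph into that of the original graph (\<open>twist_ideal\<close>), because
  the ideal is spanned by words times relators times words (\<open>lpa_ideal_induct\<close>), and each relator
  goes to a relator at whatever height it is read (\<open>twist_relator\<close>).  The twists form a family
  \<open>twist k n\<close> closed under composition (\<open>twist_twist\<close>).  It contains the powers of \<open>\<sigma>\<close>, as
  \<open>k = 0\<close>, and also the inverse of the bijection, as \<open>k = -1\<close>: the original graph is the
  twist of the twisted graph by the inverse automorphism.  One computation therefore gives that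
  \<open>\<sigma>\<close> is well defined on the quotient, and that the map and its inverse are.

  Since ideals spanned by homogeneous elements have graded quotients, Leavitt path algebras are
  graded algebras (\<open>graded_algebra_lpa\<close>), with homogeneous parts computed on representatives
  (\<open>homog_part_lpa\<close>).  This makes the twisted product explicit (\<open>A_mult\<close>) and shows that the map
  is multiplicative.  The axioms for the twist, including associativity and the identity
  element, are then transported back from the Leavitt path algebra of the twisted graph.
\<close>

section \<open>Linear extension of maps defined on words\<close>

text \<open>
  Every map below that acts word by word (replacing letters, selecting a degree) is an instance
  of this extension; the field acts on the target by multiplication with multiples of the empty
  word.
\<close>

definition linear_extension ::
    "('w \<Rightarrow> ('u::monoid_add \<Rightarrow>\<^sub>0 'k)) \<Rightarrow> ('w \<Rightarrow>\<^sub>0 'k::field) \<Rightarrow> 'u \<Rightarrow>\<^sub>0 'k" where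
  "linear_extension f x =
     (\<Sum>w\<in>Poly_Mapping.keys x. Poly_Mapping.single 0 (Poly_Mapping.lookup x w) * f w)"

lemma linear_extension_superset:
  assumes "finite S" "Poly_Mapping.keys x \<subseteq> S"
  shows "linear_extension f x = (\<Sum>w\<in>S. Poly_Mapping.single 0 (Poly_Mapping.lookup x w) * f w)"
  unfolding linear_extension_def
  by (rule sum.mono_neutral_left) (use assms in \<open>auto simp: in_keys_iff\<close>)

lemma linear_extension_single [simp]:
  "linear_extension f (Poly_Mapping.single w c) = Poly_Mapping.single 0 c * f w"
  by (simp add: linear_extension_def)

lemma linear_extension_zero [simp]: "linear_extension f 0 = 0"
  by (simp add: linear_extension_def)

lemma linear_extension_add: "linear_extension f (x + y) = linear_extension f x + linear_extension f y"
proof -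
  let ?S = "Poly_Mapping.keys x \<union> Poly_Mapping.keys y"
  have "linear_extension f z = (\<Sum>w\<in>?S. Poly_Mapping.single 0 (Poly_Mapping.lookup z w) * f w)"
    if "z \<in> {x, y, x + y}" for z
    by (rule linear_extension_superset) (use that keys_add[of x y] in auto)
  then show ?thesis
    by (simp add: lookup_add single_add distrib_right sum.distrib)
qed

lemma linear_extension_uminus: "linear_extension f (- x) = - linear_extension f x"
  by (metis add.right_inverse linear_extension_add linear_extension_zero minus_unique)

lemma linear_extension_diff: "linear_extension f (x - y) = linear_extension f x - linear_extension f y"
  by (metis diff_conv_add_uminus linear_extension_add linear_extension_uminus)

lemma linear_extension_sum: "linear_extension f (sum g S) = (\<Sum>i\<in>S. linear_extension f (g i))"
  by (induction S rule: infinite_finite_induct) (simp_all add: linear_extension_add)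

lemma sum_monomials:
  "(\<Sum>w\<in>Poly_Mapping.keys x. Poly_Mapping.single w (Poly_Mapping.lookup x w)) = x"
proof (rule poly_mapping_eqI)
  fix v
  show "Poly_Mapping.lookup (\<Sum>w\<in>Poly_Mapping.keys x. Poly_Mapping.single w (Poly_Mapping.lookup x w)) v
      = Poly_Mapping.lookup x v"
    by (simp add: lookup_sum lookup_single when_def in_keys_iff)
qed

lemma additive_induct [consumes 1, case_names zero add single]:
  fixes x :: "'w \<Rightarrow>\<^sub>0 'k::ab_group_add"
  assumes "Poly_Mapping.keys x \<subseteq> S"
    and zero: "P 0"
    and add: "\<And>y z. P y \<Longrightarrow> P z \<Longrightarrow> P (y + z)"
    and single: "\<And>w c. w \<in> S \<Longrightarrow> P (Poly_Mapping.single w c)"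
  shows "P x"
proof -
  have "P (\<Sum>w\<in>T. Poly_Mapping.single w (Poly_Mapping.lookup x w))"
    if "finite T" "T \<subseteq> Poly_Mapping.keys x" for T
    using that by (induction T rule: finite_induct) (use assms in auto)
  from this[OF finite_keys order_refl] show ?thesis
    by (simp add: sum_monomials)
qed

lemma scalar_commute:
  fixes x :: "'a::monoid_add \<Rightarrow>\<^sub>0 'k::field"
  shows "x * Poly_Mapping.single 0 c = Poly_Mapping.single 0 c * x"
  using subset_UNIV[of "Poly_Mapping.keys x"]
proof (induction rule: additive_induct)
  case (single w d)
  then show ?case by (simp add: mult_single mult.commute)
qed (simp_all add: algebra_simps)

lemma linear_extension_scalar:
  "linear_extension f (Poly_Mapping.single 0 c * x) = Poly_Mapping.single 0 c * linear_extension f x"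
  using subset_UNIV[of "Poly_Mapping.keys x"]
proof (induction rule: additive_induct)
  case (single w d)
  have "Poly_Mapping.single 0 c * (Poly_Mapping.single 0 d * f w)
      = Poly_Mapping.single 0 (c * d) * f w"
    by (simp only: mult.assoc[symmetric] mult_single add_0_left)
  then show ?case by (simp add: mult_single)
qed (simp_all add: distrib_left linear_extension_add)

lemma keys_linear_extension_subset:
  assumes "\<And>w. w \<in> Poly_Mapping.keys x \<Longrightarrow> Poly_Mapping.keys (f w) \<subseteq> S"
  shows "Poly_Mapping.keys (linear_extension f x) \<subseteq> S"
proof -
  have "Poly_Mapping.keys (Poly_Mapping.single 0 c * f w) \<subseteq> S" if "w \<in> Poly_Mapping.keys x" for w c
    using keys_mult[of "Poly_Mapping.single 0 c" "f w"] assms[OF that] by (auto split: if_splits)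
  then show ?thesis
    unfolding linear_extension_def by (intro order_trans[OF keys_sum] UN_least)
qed


section \<open>Degrees in the free algebra\<close>

lemma letters_add [simp]: "letters (u + v) = letters u @ letters v"
  by (simp add: plus_word_def)

lemma letters_zero [simp]: "letters 0 = []"
  by (simp add: zero_word_def)

lemma word_eq_zero_iff: "w = 0 \<longleftrightarrow> letters w = []"
  by (cases w) (simp add: zero_word_def)

lemma word_degree_zero [simp]: "word_degree 0 = 0"
  by (simp add: word_degree_def)

lemma word_degree_add [simp]: "word_degree (u + v) = word_degree u + word_degree v"
  by (simp add: word_degree_def)

definition homogeneous :: "int \<Rightarrow> ('v, 'e, 'k::field) free_elem \<Rightarrow> bool" where
  "homogeneous n x \<longleftrightarrow> (\<forall>w\<in>Poly_Mapping.keys x. word_degree w = n)"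

lemma homogeneous_zero [simp]: "homogeneous n 0"
  by (simp add: homogeneous_def)

lemma homogeneous_single: "word_degree w = n \<Longrightarrow> homogeneous n (Poly_Mapping.single w c)"
  by (simp add: homogeneous_def)

lemma homogeneous_gen: "gen_degree g = n \<Longrightarrow> homogeneous n (gen_elem g)"
  by (simp add: gen_elem_def homogeneous_single word_degree_def)

lemma homogeneous_add: "homogeneous n x \<Longrightarrow> homogeneous n y \<Longrightarrow> homogeneous n (x + y)"
  using keys_add[of x y] by (auto simp: homogeneous_def)

lemma homogeneous_uminus: "homogeneous n x \<Longrightarrow> homogeneous n (- x)"
  by (simp add: homogeneous_def in_keys_iff)

lemma homogeneous_diff: "homogeneous n x \<Longrightarrow> homogeneous n y \<Longrightarrow> homogeneous n (x - y)"
  by (metis diff_conv_add_uminus homogeneous_add homogeneous_uminus)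

lemma homogeneous_sum: "(\<And>i. i \<in> S \<Longrightarrow> homogeneous n (f i)) \<Longrightarrow> homogeneous n (sum f S)"
  by (induction S rule: infinite_finite_induct) (simp_all add: homogeneous_add)

lemma homogeneous_mult: "homogeneous m x \<Longrightarrow> homogeneous n y \<Longrightarrow> homogeneous (m + n) (x * y)"
  using keys_mult[of x y] by (fastforce simp: homogeneous_def)

lemma homogeneous_gen_mult:
  "gen_degree g + gen_degree h = n \<Longrightarrow> homogeneous n (gen_elem g * gen_elem h)"
  using homogeneous_mult[OF homogeneous_gen homogeneous_gen, OF refl refl] by blast

lemma homogeneous_scalar: "homogeneous n x \<Longrightarrow> homogeneous n (Poly_Mapping.single 0 c * x)"
  using homogeneous_mult[of 0 "Poly_Mapping.single 0 c" n x] by (simp add: homogeneous_single)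

definition component :: "int \<Rightarrow> ('v, 'e, 'k::field) free_elem \<Rightarrow> ('v, 'e, 'k) free_elem" where
  "component n = linear_extension (\<lambda>w. if word_degree w = n then Poly_Mapping.single w 1 else 0)"

lemma component_zero [simp]: "component n 0 = 0"
  by (simp add: component_def)

lemma component_add: "component n (x + y) = component n x + component n y"
  by (simp add: component_def linear_extension_add)

lemma component_diff: "component n (x - y) = component n x - component n y"
  by (simp add: component_def linear_extension_diff)

lemma component_sum: "component n (sum f S) = (\<Sum>i\<in>S. component n (f i))"
  by (simp add: component_def linear_extension_sum)

lemma component_single:
  "component n (Poly_Mapping.single w c) = (if word_degree w = n then Poly_Mapping.single w c else 0)"
  by (simp add: component_def mult_single)

lemma keys_component: "Poly_Mapping.keys (component n x) \<subseteq> {w \<in> Poly_Mapping.keys x. word_degree w = n}"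
  unfolding component_def by (rule keys_linear_extension_subset) (auto split: if_splits)

lemma homogeneous_component: "homogeneous n (component n x)"
  using keys_component[of n x] by (auto simp: homogeneous_def)

lemma component_of_homogeneous:
  assumes "homogeneous m x"
  shows "component n x = (if n = m then x else 0)"
proof -
  have "Poly_Mapping.keys x \<subseteq> {w. word_degree w = m}"
    using assms by (auto simp: homogeneous_def)
  then show ?thesis
    by (induction rule: additive_induct) (auto simp: component_add component_single)
qed

lemma sum_components:
  assumes "finite S" "word_degree ` Poly_Mapping.keys x \<subseteq> S"
  shows "(\<Sum>n\<in>S. component n x) = x"
proof -
  have "Poly_Mapping.keys x \<subseteq> {w. word_degree w \<in> S}"
    using assms(2) by auto
  then show ?thesis
    by (induction rule: additive_induct)
      (auto simp: component_add component_single sum.distrib sum.delta assms(1))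
qed

lemma component_eq_zero: "n \<notin> word_degree ` Poly_Mapping.keys x \<Longrightarrow> component n x = 0"
  using keys_component[of n x] by (metis (mono_tags, lifting) Collect_empty_eq image_eqI keys_eq_empty subset_empty)


section \<open>The free algebra and the Leavitt ideal\<close>

lemma free_alg_add: "x \<in> free_alg E \<Longrightarrow> y \<in> free_alg E \<Longrightarrow> x + y \<in> free_alg E"
  using keys_add[of x y] by (auto simp: free_alg_def)

lemma free_alg_zero [simp]: "0 \<in> free_alg E"
  by (simp add: free_alg_def)

lemma free_alg_uminus: "x \<in> free_alg E \<Longrightarrow> - x \<in> free_alg E"
  by (simp add: free_alg_def in_keys_iff)

lemma free_alg_sum: "(\<And>i. i \<in> S \<Longrightarrow> f i \<in> free_alg E) \<Longrightarrow> sum f S \<in> free_alg E"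
  by (induction S rule: infinite_finite_induct) (simp_all add: free_alg_add)

lemma free_alg_mult: "x \<in> free_alg E \<Longrightarrow> y \<in> free_alg E \<Longrightarrow> x * y \<in> free_alg E"
  using keys_mult[of x y] by (fastforce simp: free_alg_def word_eq_zero_iff)

lemma free_alg_scale: "x \<in> free_alg E \<Longrightarrow> scale c x \<in> free_alg E"
  using keys_mult[of "Poly_Mapping.single 0 c" x]
  by (fastforce simp: free_alg_def scale_def split: if_splits)

lemma free_alg_single:
  "w \<noteq> 0 \<Longrightarrow> set (letters w) \<subseteq> gens E \<Longrightarrow> Poly_Mapping.single w c \<in> free_alg E"
  by (simp add: free_alg_def)

lemma free_alg_gen: "g \<in> gens E \<Longrightarrow> gen_elem g \<in> free_alg E"
  by (simp add: gen_elem_def free_alg_single word_eq_zero_iff)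

lemma free_alg_component: "x \<in> free_alg E \<Longrightarrow> component n x \<in> free_alg E"
  using keys_component[of n x] by (auto simp: free_alg_def)

lemma free_homog_iff: "x \<in> free_homog E n \<longleftrightarrow> x \<in> free_alg E \<and> homogeneous n x"
  by (simp add: free_homog_def homogeneous_def)

lemma ideal_uminus: "x \<in> lpa_ideal E \<Longrightarrow> - x \<in> lpa_ideal E"
  using lpa_ideal.scale[of x E "- 1"] by (simp add: scale_def single_uminus)

lemma ideal_diff: "x \<in> lpa_ideal E \<Longrightarrow> y \<in> lpa_ideal E \<Longrightarrow> x - y \<in> lpa_ideal E"
  by (metis diff_conv_add_uminus lpa_ideal.add ideal_uminus)

lemma ideal_sum: "(\<And>i. i \<in> S \<Longrightarrow> f i \<in> lpa_ideal E) \<Longrightarrow> sum f S \<in> lpa_ideal E"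
  by (induction S rule: infinite_finite_induct) (simp_all add: lpa_ideal.add lpa_ideal.zero)

lemma ideal_monomial_left:
  assumes "x \<in> lpa_ideal E" "set (letters u) \<subseteq> gens E"
  shows "Poly_Mapping.single u c * x \<in> lpa_ideal E"
  using assms by (cases "u = 0")
    (auto intro: lpa_ideal.mult_left free_alg_single dest: lpa_ideal.scale[of _ _ c] simp: scale_def)

lemma ideal_monomial_right:
  assumes "x \<in> lpa_ideal E" "set (letters u) \<subseteq> gens E"
  shows "x * Poly_Mapping.single u c \<in> lpa_ideal E"
  using assms by (cases "u = 0")
    (auto intro: lpa_ideal.mult_right free_alg_single dest: lpa_ideal.scale[of _ _ c]
      simp: scale_def scalar_commute)

text \<open>
  The ideal is spanned by the products of a relator with words on both sides.  All of these
  products are homogeneous, unlike the general elements in the inductive definition of the ideal,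
  so this is the form in which grading arguments become checks on single products.
\<close>

lemma lpa_ideal_induct [consumes 1, case_names zero add monomial]:
  assumes "x \<in> lpa_ideal E"
    and zero: "P 0"
    and add: "\<And>y z. P y \<Longrightarrow> P z \<Longrightarrow> P (y + z)"
    and monomial: "\<And>u v c r. \<lbrakk>r \<in> lpa_relators E; set (letters u) \<subseteq> gens E; set (letters v) \<subseteq> gens E\<rbrakk>
      \<Longrightarrow> P (Poly_Mapping.single u c * r * Poly_Mapping.single v 1)"
  shows "P x"
proof -
  let ?s = "Poly_Mapping.single"
  \<comment> \<open>Quantifying over the words on both sides makes the claim stable under multiplication, since a
    factor from the free algebra can be absorbed into them monomial by monomial.\<close>
  have "P (?s u c * x * ?s v 1)"
    if "set (letters u) \<subseteq> gens E" "set (letters v) \<subseteq> gens E" for u v c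
    using assms(1) that
  proof (induction arbitrary: u v c rule: lpa_ideal.induct)
    case (relator x)
    then show ?case using monomial by blast
  next
    case zero
    then show ?case using assms(2) by simp
  next
    case (add x y)
    then show ?case using assms(3) by (simp add: distrib_left distrib_right)
  next
    case (scale x d)
    have "?s u c * scale d x * ?s v 1 = ?s u (c * d) * x * ?s v 1"
      by (simp add: scale_def mult.assoc[symmetric] mult_single)
    then show ?case using scale by metis
  next
    case (mult_left x a)
    have "Poly_Mapping.keys a \<subseteq> {w. set (letters w) \<subseteq> gens E}"
      using mult_left.hyps(2) by (auto simp: free_alg_def)
    then show ?case
    proof (induction rule: additive_induct)
      case (single w d)
      have "?s u c * (?s w d * x) * ?s v 1 = ?s (u + w) (c * d) * x * ?s v 1"
        by (simp add: mult.assoc[symmetric] mult_single)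
      then show ?case using mult_left.IH[of "u + w" v "c * d"] mult_left.prems single by simp
    qed (use assms(2,3) in \<open>simp_all add: distrib_left distrib_right\<close>)
  next
    case (mult_right x a)
    have "Poly_Mapping.keys a \<subseteq> {w. set (letters w) \<subseteq> gens E}"
      using mult_right.hyps(2) by (auto simp: free_alg_def)
    then show ?case
    proof (induction rule: additive_induct)
      case (single w d)
      have "?s w d * ?s v 1 = ?s 0 d * ?s (w + v) 1"
        by (simp add: mult_single)
      then have "?s u c * (x * ?s w d) * ?s v 1 = ?s u c * (x * ?s 0 d) * ?s (w + v) 1"
        by (simp add: mult.assoc)
      also have "\<dots> = ?s u (c * d) * x * ?s (w + v) 1"
        by (simp only: scalar_commute) (simp add: mult.assoc[symmetric] mult_single)
      finally show ?case using mult_right.IH[of u "w + v" "c * d"] mult_right.prems single by simp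
    qed (use assms(2,3) in \<open>simp_all add: distrib_left distrib_right\<close>)
  qed
  from this[of 0 0 1] show ?thesis by simp
qed

lemma relator_homogeneous:
  assumes "r \<in> lpa_relators E"
  obtains d where "homogeneous d r"
proof -
  note h = homogeneous_diff homogeneous_gen_mult homogeneous_sum homogeneous_gen
  from assms have "homogeneous 0 r \<or> homogeneous 1 r \<or> homogeneous (-1) r"
    unfolding lpa_relators_def
  proof (elim UnE CollectE exE conjE)
    fix v w assume "r = vx v * vx w - (if v = w then vx w else 0)"
    then have "homogeneous 0 r" by (auto intro!: h)
    then show ?thesis by blast
  next
    fix e assume "r = vx (tail E e) * ed e - ed e"
    then have "homogeneous 1 r" by (auto intro!: h)
    then show ?thesis by blast
  next
    fix e assume "r = ed e * vx (head E e) - ed e"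
    then have "homogeneous 1 r" by (auto intro!: h)
    then show ?thesis by blast
  next
    fix e assume "r = gh e * vx (tail E e) - gh e"
    then have "homogeneous (-1) r" by (auto intro!: h)
    then show ?thesis by blast
  next
    fix e assume "r = vx (head E e) * gh e - gh e"
    then have "homogeneous (-1) r" by (auto intro!: h)
    then show ?thesis by blast
  next
    fix e f assume "r = gh e * ed f - (if e = f then vx (head E e) else 0)"
    then have "homogeneous 0 r" by (auto intro!: h)
    then show ?thesis by blast
  next
    fix v assume "r = vx v - (\<Sum>e\<in>out_arcs E v. ed e * gh e)"
    then have "homogeneous 0 r" by (auto intro!: h)
    then show ?thesis by blast
  qed
  then show thesis using that by blast
qed

text \<open>
  The ideal is homogeneous: it contains the components of its elements, because it is spanned by
  homogeneous elements.  This is what makes the quotient graded.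
\<close>

lemma ideal_component:
  assumes "x \<in> lpa_ideal E"
  shows "component n x \<in> lpa_ideal E"
  using assms
proof (induction rule: lpa_ideal_induct)
  case (monomial u v c r)
  let ?y = "Poly_Mapping.single u c * r * Poly_Mapping.single v 1"
  obtain d where "homogeneous d r" using relator_homogeneous[OF monomial(1)] .
  then have "homogeneous (word_degree u + d + word_degree v) ?y"
    by (intro homogeneous_mult homogeneous_single) simp_all
  moreover have "?y \<in> lpa_ideal E"
    by (intro ideal_monomial_left ideal_monomial_right lpa_ideal.relator monomial)
  ultimately show ?case
    by (simp add: component_of_homogeneous lpa_ideal.zero)
qed (simp_all add: component_add lpa_ideal.add lpa_ideal.zero)

section \<open>Leavitt path algebras as graded algebras\<close>

lemma equiv_lpa_rel: "equiv (free_alg E) (lpa_rel E)"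
proof (intro equivI)
  show "lpa_rel E \<subseteq> free_alg E \<times> free_alg E"
    by (auto simp: lpa_rel_def)
  show "refl_on (free_alg E) (lpa_rel E)"
    by (auto intro!: refl_onI simp: lpa_rel_def lpa_ideal.zero)
  show "sym (lpa_rel E)"
    by (rule symI) (use ideal_uminus in \<open>fastforce simp: lpa_rel_def\<close>)
  show "trans (lpa_rel E)"
  proof (rule transI)
    fix x y z assume "(x, y) \<in> lpa_rel E" "(y, z) \<in> lpa_rel E"
    then show "(x, z) \<in> lpa_rel E"
      using lpa_ideal.add[of "x - y" E "y - z"] by (auto simp: lpa_rel_def)
  qed
qed

lemma class_eq_iff:
  "x \<in> free_alg E \<Longrightarrow> y \<in> free_alg E \<Longrightarrow> lpa_class E x = lpa_class E y \<longleftrightarrow> x - y \<in> lpa_ideal E"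
  unfolding lpa_class_def using eq_equiv_class_iff[OF equiv_lpa_rel] by (auto simp: lpa_rel_def)

lemma class_eqI:
  "x \<in> free_alg E \<Longrightarrow> y \<in> free_alg E \<Longrightarrow> x - y \<in> lpa_ideal E \<Longrightarrow> lpa_class E x = lpa_class E y"
  by (simp add: class_eq_iff)

text \<open>
  The operations of the Leavitt path algebra are unions over representatives.  The following two
  rules evaluate such a union at any representatives once the operation is known to respect
  congruence.
\<close>

lemma UN_class:
  assumes "\<And>x y. \<lbrakk>x \<in> free_alg E; y \<in> free_alg E; x - y \<in> lpa_ideal E\<rbrakk> \<Longrightarrow> f x = f y"
    and "a \<in> free_alg E"
  shows "(\<Union>x\<in>lpa_class E a. f x) = f a"
  unfolding lpa_class_def
  by (rule UN_equiv_class[OF equiv_lpa_rel]) (auto simp: congruent_def lpa_rel_def assms)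

lemma UN_class2:
  assumes "\<And>x y z. \<lbrakk>x \<in> free_alg E; y \<in> free_alg E; z \<in> free_alg E; x - y \<in> lpa_ideal E\<rbrakk> \<Longrightarrow> f x z = f y z"
    and "\<And>x y z. \<lbrakk>x \<in> free_alg E; y \<in> free_alg E; z \<in> free_alg E; x - y \<in> lpa_ideal E\<rbrakk> \<Longrightarrow> f z x = f z y"
    and "a \<in> free_alg E" "b \<in> free_alg E"
  shows "(\<Union>x\<in>lpa_class E a. \<Union>y\<in>lpa_class E b. f x y) = f a b"
proof -
  have "(\<Union>x\<in>lpa_class E a. \<Union>y\<in>lpa_class E b. f x y) = (\<Union>x\<in>lpa_class E a. f x b)"
  proof (intro SUP_cong refl UN_class assms(2,4))
    show "x \<in> free_alg E" if "x \<in> lpa_class E a" for x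
      using that by (simp add: lpa_class_def lpa_rel_def)
  qed
  also have "\<dots> = f a b"
    by (intro UN_class assms)
  finally show ?thesis .
qed

context
  fixes E :: "('v, 'e) pre_digraph" and A :: "('k::field, ('v, 'e, 'k) free_elem set) graded_alg"
  defines "A \<equiv> leavitt_path_algebra TYPE('k) E"
begin

lemma lpa_carrier: "carrier A = lpa_class E ` free_alg E"
  by (auto simp: A_def leavitt_path_algebra_def quotient_def lpa_class_def)

lemma lpa_zero: "\<zero>\<^bsub>A\<^esub> = lpa_class E 0"
  by (simp add: A_def leavitt_path_algebra_def)

lemma lpa_one: "\<one>\<^bsub>A\<^esub> = lpa_class E (\<Sum>v\<in>verts E. vx v)"
  by (simp add: A_def leavitt_path_algebra_def)

lemma lpa_homog: "homog A n = lpa_class E ` free_homog E n"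
  by (simp add: A_def leavitt_path_algebra_def)

lemma lpa_add:
  assumes "x \<in> free_alg E" "y \<in> free_alg E"
  shows "lpa_class E x \<oplus>\<^bsub>A\<^esub> lpa_class E y = lpa_class E (x + y)"
  unfolding A_def leavitt_path_algebra_def ring_record_simps
  by (rule UN_class2) (simp_all add: class_eq_iff free_alg_add assms)

lemma lpa_mult:
  assumes "x \<in> free_alg E" "y \<in> free_alg E"
  shows "lpa_class E x \<otimes>\<^bsub>A\<^esub> lpa_class E y = lpa_class E (x * y)"
  unfolding A_def leavitt_path_algebra_def ring_record_simps
proof (rule UN_class2)
  fix x y z :: "('v, 'e, 'k) free_elem"
  assume *: "x \<in> free_alg E" "y \<in> free_alg E" "z \<in> free_alg E" "x - y \<in> lpa_ideal E"
  show "lpa_class E (x * z) = lpa_class E (y * z)"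
    using lpa_ideal.mult_right[OF *(4,3)] *
    by (intro class_eqI) (auto simp: left_diff_distrib free_alg_mult)
  show "lpa_class E (z * x) = lpa_class E (z * y)"
    using lpa_ideal.mult_left[OF *(4,3)] *
    by (intro class_eqI) (auto simp: right_diff_distrib free_alg_mult)
qed (use assms in auto)

lemma lpa_smult:
  assumes "x \<in> free_alg E"
  shows "c \<odot>\<^bsub>A\<^esub> lpa_class E x = lpa_class E (scale c x)"
  unfolding A_def leavitt_path_algebra_def module.simps
proof (rule UN_class)
  fix x y :: "('v, 'e, 'k) free_elem"
  assume *: "x \<in> free_alg E" "y \<in> free_alg E" "x - y \<in> lpa_ideal E"
  have "scale c x - scale c y = scale c (x - y)"
    by (simp add: scale_def right_diff_distrib)
  then show "lpa_class E (scale c x) = lpa_class E (scale c y)"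
    using * by (intro class_eqI) (auto intro: lpa_ideal.scale free_alg_scale)
qed (use assms in auto)

lemmas lpa_class_simps = lpa_carrier lpa_zero lpa_homog lpa_add lpa_mult lpa_smult

lemma abelian_group_lpa: "abelian_group A"
proof (rule abelian_groupI)
  fix P assume "P \<in> carrier A"
  then obtain x where x: "x \<in> free_alg E" "P = lpa_class E x"
    by (auto simp: lpa_carrier)
  then have "lpa_class E (- x) \<in> carrier A" "lpa_class E (- x) \<oplus>\<^bsub>A\<^esub> P = \<zero>\<^bsub>A\<^esub>"
    by (auto simp: lpa_class_simps free_alg_uminus)
  then show "\<exists>Q\<in>carrier A. Q \<oplus>\<^bsub>A\<^esub> P = \<zero>\<^bsub>A\<^esub>" by blast
qed (auto simp: lpa_class_simps free_alg_add add_ac)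

lemma scale_simps:
  "scale (c + d) x = scale c x + scale d x" "scale c (x + y) = scale c x + scale c y"
  "scale (c * d) x = scale c (scale d x)" "scale 1 x = x"
  "scale c x * y = scale c (x * y)" "x * scale c y = scale c (x * y)"
  for x y :: "('v, 'e, 'k) free_elem"
proof -
  show "x * scale c y = scale c (x * y)"
    unfolding scale_def by (metis mult.assoc scalar_commute)
qed (simp_all add: scale_def single_add distrib_left distrib_right mult_single mult.assoc[symmetric])

lemma module_lpa: "module (ring_of_type_algebra :: 'k ring) A"
proof (rule moduleI)
  show "cring (ring_of_type_algebra :: 'k ring)" ..
qed (auto simp: abelian_group_lpa ring_of_type_algebra_def lpa_class_simps free_alg_add
    free_alg_scale scale_simps)

lemma lpa_finsum:
  assumes "finite S" "\<And>i. i \<in> S \<Longrightarrow> g i \<in> free_alg E"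
  shows "finsum A (\<lambda>i. lpa_class E (g i)) S = lpa_class E (sum g S)"
proof -
  interpret abelian_group A by (rule abelian_group_lpa)
  show ?thesis
    using assms
    by (induction S rule: finite_induct)
      (auto simp: lpa_class_simps Pi_def free_alg_sum)
qed

lemma homog_decomp_components:
  assumes "x \<in> free_alg E"
  shows "homog_decomp A (lpa_class E x) (\<lambda>n. lpa_class E (component n x))"
proof -
  interpret abelian_group A by (rule abelian_group_lpa)
  let ?f = "\<lambda>n. lpa_class E (component n x)"
  let ?D = "word_degree ` Poly_Mapping.keys x"
  let ?S = "{n. ?f n \<noteq> \<zero>\<^bsub>A\<^esub>}"
  have S: "?S \<subseteq> ?D"
    using component_eq_zero by (fastforce simp: lpa_zero)
  have fin: "finite ?D" by simp
  have "lpa_class E x = lpa_class E (\<Sum>n\<in>?D. component n x)"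
    by (simp add: sum_components)
  also have "\<dots> = finsum A ?f ?D"
    by (rule lpa_finsum[symmetric]) (simp_all add: assms free_alg_component)
  also have "\<dots> = finsum A ?f ?S"
    by (rule add.finprod_mono_neutral_cong_right)
      (use S in \<open>auto simp: lpa_carrier assms free_alg_component\<close>)
  finally show ?thesis
    using finite_subset[OF S fin] assms
    by (auto simp: homog_decomp_def lpa_homog free_homog_iff free_alg_component homogeneous_component)
qed

text \<open>
  Uniqueness of the homogeneous decomposition is where the homogeneity of the ideal enters: if
  \<open>x\<close> is congruent to a sum of homogeneous elements \<open>g n\<close>, then comparing components of degree \<open>n\<close>
  shows that \<open>g n\<close> is congruent to the component of \<open>x\<close>.
\<close>

lemma homog_decomp_unique:
  assumes x: "x \<in> free_alg E" and f: "homog_decomp A (lpa_class E x) f"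
  shows "f n = lpa_class E (component n x)"
proof -
  let ?S = "{n. f n \<noteq> \<zero>\<^bsub>A\<^esub>}"
  have "\<forall>n. \<exists>y. y \<in> free_homog E n \<and> f n = lpa_class E y"
    using f by (auto simp: homog_decomp_def lpa_homog)
  then obtain g where g: "\<And>n. g n \<in> free_homog E n" "\<And>n. f n = lpa_class E (g n)"
    by metis
  have fin: "finite ?S" and sum: "lpa_class E x = finsum A f ?S"
    using f by (auto simp: homog_decomp_def)
  have gf: "g n \<in> free_alg E" "homogeneous n (g n)" for n
    using g(1)[of n] by (auto simp: free_homog_iff)
  have "lpa_class E x = finsum A (\<lambda>n. lpa_class E (g n)) ?S"
    using sum by (simp only: g(2)[symmetric])
  also have "\<dots> = lpa_class E (sum g ?S)"
    by (rule lpa_finsum[OF fin gf(1)])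
  finally have "component n (x - sum g ?S) \<in> lpa_ideal E"
    by (intro ideal_component) (simp add: class_eq_iff x gf free_alg_sum)
  moreover have "component n (sum g ?S) = (\<Sum>m\<in>?S. if m = n then g m else 0)"
    unfolding component_sum by (intro sum.cong refl) (auto simp: component_of_homogeneous[OF gf(2)])
  ultimately have "component n x - (if n \<in> ?S then g n else 0) \<in> lpa_ideal E"
    by (simp add: component_diff sum.delta[OF fin])
  then have "lpa_class E (component n x) = lpa_class E (if n \<in> ?S then g n else 0)"
    by (intro class_eqI) (simp_all add: x gf free_alg_component)
  also have "\<dots> = f n"
    by (cases "n \<in> ?S") (simp_all only: if_True if_False g(2)[symmetric] lpa_zero[symmetric], simp)
  finally show ?thesis by (rule sym)
qed

lemma homog_part_lpa:
  assumes "x \<in> free_alg E"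
  shows "homog_part A (lpa_class E x) n = lpa_class E (component n x)"
  unfolding homog_part_def
  by (subst the_equality[where a = "\<lambda>n. lpa_class E (component n x)"])
    (auto simp: homog_decomp_components[OF assms] homog_decomp_unique[OF assms])

lemma submodule_homog_lpa: "submodule (homog A n) (ring_of_type_algebra :: 'k ring) A"
proof -
  interpret module "ring_of_type_algebra :: 'k ring" A by (rule module_lpa)
  show ?thesis
  proof (rule submoduleI)
    fix P assume "P \<in> homog A n"
    then obtain x where x: "x \<in> free_alg E" "homogeneous n x" "P = lpa_class E x"
      by (auto simp: lpa_homog free_homog_iff)
    have "\<ominus>\<^bsub>A\<^esub> P = lpa_class E (- x)"
      by (rule abelian_group.minus_equality[OF abelian_group_lpa]) (auto simp: x lpa_class_simps free_alg_uminus)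
    then show "\<ominus>\<^bsub>A\<^esub> P \<in> homog A n"
      using x by (auto simp: lpa_homog free_homog_iff free_alg_uminus homogeneous_uminus)
  qed (auto simp: lpa_class_simps free_homog_iff image_iff scale_def
      intro!: free_alg_add homogeneous_add free_alg_scale[unfolded scale_def] homogeneous_scalar bexI)
qed

lemma graded_algebra_lpa: "graded_algebra A"
proof (intro graded_algebra.intro module_lpa graded_algebra_axioms.intro)
  fix P assume "P \<in> carrier A"
  then obtain x where x: "x \<in> free_alg E" "P = lpa_class E x"
    by (auto simp: lpa_carrier)
  then show "\<exists>!f. homog_decomp A P f"
    using homog_decomp_components[OF x(1)] homog_decomp_unique[OF x(1)] by blast
next
  fix P Q m n assume "P \<in> homog A m" "Q \<in> homog A n"
  then obtain x y where "x \<in> free_alg E" "homogeneous m x" "P = lpa_class E x"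
      "y \<in> free_alg E" "homogeneous n y" "Q = lpa_class E y"
    by (auto simp: lpa_homog free_homog_iff)
  then show "P \<otimes>\<^bsub>A\<^esub> Q \<in> homog A (m + n)"
    by (auto simp: lpa_class_simps free_homog_iff free_alg_mult homogeneous_mult)
next
  fix n show "submodule (homog A n) (ring_of_type_algebra :: 'k ring) A"
    by (rule submodule_homog_lpa)
qed (auto simp: lpa_class_simps free_alg_add free_alg_mult free_alg_scale
    scale_simps algebra_simps)

end

section \<open>The identity for finitely many vertices\<close>

text \<open>
  Every generator absorbs one vertex on the left and one on the right; the other vertices are
  orthogonal to these and therefore annihilate it.  Hence the sum of all vertices is an identity.
\<close>

lemma gens_supported:
  fixes E :: "('v, 'e) pre_digraph" and I :: "('v, 'e, 'k::field) free_elem set"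
  defines "I \<equiv> lpa_ideal E"
  assumes "wf_digraph E" "g \<in> gens E"
  obtains a b where "a \<in> verts E" "vx a * gen_elem g - gen_elem g \<in> I"
    and "b \<in> verts E" "gen_elem g * vx b - gen_elem g \<in> I"
proof -
  let ?R = "lpa_relators E :: ('v, 'e, 'k) free_elem set"
  interpret wf_digraph E by (rule assms(2))
  have "\<exists>a\<in>verts E. \<exists>b\<in>verts E. vx a * gen_elem g - gen_elem g \<in> ?R
    \<and> gen_elem g * vx b - gen_elem g \<in> ?R"
  proof (cases g)
    case (Vertex v)
    then have "v \<in> verts E" "vx v * vx v - vx v \<in> ?R"
      using assms(3) by (auto simp: gens_def lpa_relators_def)
    then show ?thesis using Vertex by blast
  next
    case (Edge e)
    then have "e \<in> arcs E" using assms(3) by (auto simp: gens_def)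
    then have "tail E e \<in> verts E" "head E e \<in> verts E"
      "vx (tail E e) * ed e - ed e \<in> ?R" "ed e * vx (head E e) - ed e \<in> ?R"
      unfolding lpa_relators_def by simp_all blast+
    then show ?thesis using Edge by blast
  next
    case (Ghost e)
    then have "e \<in> arcs E" using assms(3) by (auto simp: gens_def)
    then have "tail E e \<in> verts E" "head E e \<in> verts E"
      "vx (head E e) * gh e - gh e \<in> ?R" "gh e * vx (tail E e) - gh e \<in> ?R"
      unfolding lpa_relators_def by simp_all blast+
    then show ?thesis using Ghost by blast
  qed
  then show thesis using that lpa_ideal.relator unfolding I_def by metis
qed

lemma distinct_vertices_orthogonal:
  assumes "v \<in> verts E" "w \<in> verts E" "v \<noteq> w"
  shows "vx v * vx w \<in> lpa_ideal E"
proof -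
  have "vx v * vx w - (if v = w then vx w else 0) \<in> lpa_relators E"
    using assms(1,2) unfolding lpa_relators_def by blast
  then show ?thesis using assms(3) lpa_ideal.relator by fastforce
qed

lemma vertex_gen: "v \<in> verts E \<Longrightarrow> Vertex v \<in> gens E"
  by (simp add: gens_def)

lemma vertex_sum_free: "(\<Sum>v\<in>verts E. vx v) \<in> free_alg E"
  by (intro free_alg_sum free_alg_gen vertex_gen)

lemma vertex_sum_left_unit:
  fixes x :: "('v, 'e, 'k::field) free_elem"
  assumes "wf_digraph E" "finite (verts E)" "x \<in> free_alg E"
  shows "(\<Sum>v\<in>verts E. vx v) * x - x \<in> lpa_ideal E"
proof -
  let ?u = "\<Sum>v\<in>verts E. vx v :: ('v, 'e, 'k) free_elem"
  let ?I = "lpa_ideal E :: ('v, 'e, 'k) free_elem set"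
  have gen: "?u * gen_elem g - gen_elem g \<in> ?I" if g: "g \<in> gens E" for g
  proof -
    obtain a where a: "a \<in> verts E" "vx a * gen_elem g - gen_elem g \<in> ?I"
      using gens_supported[OF assms(1) g] by blast
    have "vx v * gen_elem g \<in> ?I" if "v \<in> verts E - {a}" for v
    proof -
      have "vx v * vx a * gen_elem g \<in> ?I"
        by (rule lpa_ideal.mult_right) (use that a g in \<open>auto intro: distinct_vertices_orthogonal free_alg_gen\<close>)
      moreover have "vx v * (vx a * gen_elem g - gen_elem g) \<in> ?I"
        by (rule lpa_ideal.mult_left) (use that a in \<open>auto intro: free_alg_gen vertex_gen\<close>)
      ultimately show ?thesis
        using ideal_diff by (fastforce simp: algebra_simps)
    qed
    then have "(vx a * gen_elem g - gen_elem g) + (\<Sum>v\<in>verts E - {a}. vx v * gen_elem g) \<in> ?I"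
      by (intro lpa_ideal.add a ideal_sum)
    moreover have "?u * gen_elem g = vx a * gen_elem g + (\<Sum>v\<in>verts E - {a}. vx v * gen_elem g)"
      by (simp add: sum.remove[OF assms(2) a(1)] distrib_right sum_distrib_right)
    ultimately show ?thesis by (simp add: algebra_simps)
  qed
  have "Poly_Mapping.keys x \<subseteq> {w. w \<noteq> 0 \<and> set (letters w) \<subseteq> gens E}"
    using assms(3) by (auto simp: free_alg_def)
  then show ?thesis
  proof (induction rule: additive_induct)
    case (add y z)
    then have "(?u * y - y) + (?u * z - z) \<in> ?I" by (intro lpa_ideal.add)
    then show ?case by (simp add: algebra_simps)
  next
    case (single w c)
    then obtain g gs where w: "letters w = g # gs"
      by (cases "letters w") (auto simp: word_eq_zero_iff)
    then have "w = Word [g] + Word gs"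
      by (cases w) (simp add: plus_word_def)
    then have s: "Poly_Mapping.single w c = gen_elem g * Poly_Mapping.single (Word gs) c"
      by (simp add: gen_elem_def mult_single)
    have "(?u * gen_elem g - gen_elem g) * Poly_Mapping.single (Word gs) c \<in> ?I"
      using single w by (intro ideal_monomial_right gen) auto
    then show ?case by (simp add: s algebra_simps)
  qed (simp add: lpa_ideal.zero)
qed

lemma vertex_sum_right_unit:
  fixes x :: "('v, 'e, 'k::field) free_elem"
  assumes "wf_digraph E" "finite (verts E)" "x \<in> free_alg E"
  shows "x * (\<Sum>v\<in>verts E. vx v) - x \<in> lpa_ideal E"
proof -
  let ?u = "\<Sum>v\<in>verts E. vx v :: ('v, 'e, 'k) free_elem"
  let ?I = "lpa_ideal E :: ('v, 'e, 'k) free_elem set"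
  have gen: "gen_elem g * ?u - gen_elem g \<in> ?I" if g: "g \<in> gens E" for g
  proof -
    obtain a where a: "a \<in> verts E" "gen_elem g * vx a - gen_elem g \<in> ?I"
      using gens_supported[OF assms(1) g] by blast
    have "gen_elem g * vx v \<in> ?I" if "v \<in> verts E - {a}" for v
    proof -
      have "gen_elem g * (vx a * vx v) \<in> ?I"
        by (rule lpa_ideal.mult_left) (use that a g in \<open>auto intro: distinct_vertices_orthogonal free_alg_gen\<close>)
      moreover have "(gen_elem g * vx a - gen_elem g) * vx v \<in> ?I"
        by (rule lpa_ideal.mult_right) (use that a in \<open>auto intro: free_alg_gen vertex_gen\<close>)
      ultimately show ?thesis
        using ideal_diff by (fastforce simp: algebra_simps)
    qed
    then have "(gen_elem g * vx a - gen_elem g) + (\<Sum>v\<in>verts E - {a}. gen_elem g * vx v) \<in> ?I"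
      by (intro lpa_ideal.add a ideal_sum)
    moreover have "gen_elem g * ?u = gen_elem g * vx a + (\<Sum>v\<in>verts E - {a}. gen_elem g * vx v)"
      by (simp add: sum.remove[OF assms(2) a(1)] distrib_left sum_distrib_left)
    ultimately show ?thesis by (simp add: algebra_simps)
  qed
  have "Poly_Mapping.keys x \<subseteq> {w. w \<noteq> 0 \<and> set (letters w) \<subseteq> gens E}"
    using assms(3) by (auto simp: free_alg_def)
  then show ?thesis
  proof (induction rule: additive_induct)
    case (add y z)
    then have "(y * ?u - y) + (z * ?u - z) \<in> ?I" by (intro lpa_ideal.add)
    then show ?case by (simp add: algebra_simps)
  next
    case (single w c)
    then obtain gs g where w: "letters w = gs @ [g]"
      by (cases "letters w" rule: rev_cases) (auto simp: word_eq_zero_iff)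
    then have "w = Word gs + Word [g]"
      by (cases w) (simp add: plus_word_def)
    then have s: "Poly_Mapping.single w c = Poly_Mapping.single (Word gs) c * gen_elem g"
      by (simp add: gen_elem_def mult_single)
    have "Poly_Mapping.single (Word gs) c * (gen_elem g * ?u - gen_elem g) \<in> ?I"
      using single w by (intro ideal_monomial_left gen) auto
    then show ?case by (simp add: s algebra_simps)
  qed (simp add: lpa_ideal.zero)
qed

lemma ring_lpa:
  fixes E :: "('v, 'e) pre_digraph"
  assumes "wf_digraph E" "finite (verts E)"
  shows "ring (leavitt_path_algebra TYPE('k::field) E)"
proof (rule ringI)
  show "abelian_group (leavitt_path_algebra TYPE('k) E)" by (rule abelian_group_lpa)
  have unit: "lpa_class E ((\<Sum>v\<in>verts E. vx v) * x) = lpa_class E x"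
    "lpa_class E (x * (\<Sum>v\<in>verts E. vx v)) = lpa_class E x"
    if "x \<in> free_alg E" for x :: "('v, 'e, 'k) free_elem"
    using that
    by (simp_all add: class_eq_iff free_alg_mult vertex_sum_free vertex_sum_left_unit
        vertex_sum_right_unit assms)
  show "monoid (leavitt_path_algebra TYPE('k) E)"
    by (rule monoidI)
      (auto simp: lpa_class_simps lpa_one vertex_sum_free free_alg_mult mult.assoc
        unit)
qed (auto simp: lpa_class_simps free_alg_mult free_alg_add algebra_simps)


section \<open>Integer actions on a graph and the twist of words\<close>

text \<open>
  The powers of a graph automorphism, as an action of \<open>\<int>\<close>.  The maps are bijections of the whole
  types of vertices and edges, so that acting on words is invertible without reference to the
  graph.
\<close>

locale integer_graph_action = wf_digraph E
  for E :: "('v, 'e) pre_digraph" +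
  fixes p :: "int \<Rightarrow> 'v \<Rightarrow> 'v" and q :: "int \<Rightarrow> 'e \<Rightarrow> 'e"
  assumes p_zero [simp]: "p 0 v = v" and p_add: "p (m + n) v = p m (p n v)"
    and q_zero [simp]: "q 0 e = e" and q_add: "q (m + n) e = q m (q n e)"
    and p_verts: "v \<in> verts E \<Longrightarrow> p n v \<in> verts E"
    and q_arcs: "e \<in> arcs E \<Longrightarrow> q n e \<in> arcs E"
    and tail_q: "e \<in> arcs E \<Longrightarrow> tail E (q n e) = p n (tail E e)"
    and head_q: "e \<in> arcs E \<Longrightarrow> head E (q n e) = p n (head E e)"
begin

lemma p_cancel [simp]: "p (- n) (p n v) = v" "p n (p (- n) v) = v"
  using p_add[of "- n" n v] p_add[of n "- n" v] by simp_all

lemma q_cancel [simp]: "q (- n) (q n e) = e" "q n (q (- n) e) = e"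
  using q_add[of "- n" n e] q_add[of n "- n" e] by simp_all

lemma p_eq_iff [simp]: "p n v = p n w \<longleftrightarrow> v = w"
  by (metis p_cancel(1))

lemma q_eq_iff [simp]: "q n e = q n f \<longleftrightarrow> e = f"
  by (metis q_cancel(1))

lemma out_arcs_shift: "out_arcs E (p n v) = q n ` out_arcs E v"
proof
  show "q n ` out_arcs E v \<subseteq> out_arcs E (p n v)"
    by (auto simp: out_arcs_def q_arcs tail_q)
  show "out_arcs E (p n v) \<subseteq> q n ` out_arcs E v"
  proof
    fix e assume "e \<in> out_arcs E (p n v)"
    then have "q (- n) e \<in> out_arcs E v"
      by (auto simp: out_arcs_def q_arcs tail_q)
    then show "e \<in> q n ` out_arcs E v"
      by (metis image_eqI q_cancel(2))
  qed
qed

definition shift :: "int \<Rightarrow> ('v, 'e) gen \<Rightarrow> ('v, 'e) gen" where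
  "shift n = map_gen (p n) (q n)"

lemma shift_simps [simp]:
  "shift n (Vertex v) = Vertex (p n v)" "shift n (Edge e) = Edge (q n e)" "shift n (Ghost e) = Ghost (q n e)"
  by (simp_all add: shift_def)

lemma shift_zero [simp]: "shift 0 g = g"
  by (cases g) simp_all

lemma shift_shift: "shift m (shift n g) = shift (m + n) g"
  by (cases g) (simp_all add: p_add q_add)

lemma gen_degree_shift [simp]: "gen_degree (shift n g) = gen_degree g"
  by (cases g) simp_all

lemma shift_gens: "g \<in> gens E \<Longrightarrow> shift n g \<in> gens E"
  by (auto simp: gens_def p_verts q_arcs)

text \<open>
  Reading a word from left to right, a letter \<open>g\<close> leads from a height \<open>h\<close> to the height
  \<open>h + deg g\<close>.  For \<open>k = 1\<close> and initial height \<open>n\<close>, the letter is shifted by the lower of the two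
  heights.  The starting height alone is what the product \<open>a \<cdot> \<sigma>\<^sup>m(b)\<close> demands for vertices and
  edges; a ghost edge needs the extra shift by \<open>-1\<close>, since it is \<open>\<sigma>\<^sup>-\<^sup>1(e)\<^sup>*\<close> and not \<open>e\<^sup>*\<close> that satisfies
  the Leavitt relations for the product of the twist.

  In general the height changes by \<open>k deg g\<close>, and the extra shift of a ghost edge is \<open>-k\<close>.  So
  \<open>k = 0\<close> gives the automorphism \<open>\<sigma>\<^sup>n\<close>, and \<open>k = -1\<close> with \<open>n = 0\<close> inverts the case \<open>k = 1\<close>, \<open>n = 0\<close>.
\<close>

primrec twist_letters :: "int \<Rightarrow> int \<Rightarrow> ('v, 'e) gen list \<Rightarrow> ('v, 'e) gen list" where
  "twist_letters k n [] = []"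
| "twist_letters k n (g # gs) =
     shift (n + k * min 0 (gen_degree g)) g # twist_letters k (n + k * gen_degree g) gs"

definition twist_word :: "int \<Rightarrow> int \<Rightarrow> ('v, 'e) gen word \<Rightarrow> ('v, 'e) gen word" where
  "twist_word k n w = Word (twist_letters k n (letters w))"

lemma twist_letters_append:
  "twist_letters k n (gs @ hs)
   = twist_letters k n gs @ twist_letters k (n + k * (\<Sum>g\<leftarrow>gs. gen_degree g)) hs"
  by (induction gs arbitrary: n) (simp_all add: algebra_simps)

text \<open>
  A shift preserves degrees, so both passes see the same heights and the amounts of the shifts
  add up.
\<close>

lemma twist_letters_twist_letters:
  "twist_letters k n (twist_letters l m gs) = twist_letters (k + l) (n + m) gs"
  by (induction gs arbitrary: m n) (simp_all add: algebra_simps shift_shift)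

lemma twist_letters_id: "twist_letters 0 0 gs = gs"
  by (induction gs) simp_all

lemma degree_twist_letters: "(\<Sum>g\<leftarrow>twist_letters k n gs. gen_degree g) = (\<Sum>g\<leftarrow>gs. gen_degree g)"
  by (induction gs arbitrary: n) simp_all

lemma twist_letters_gens: "set gs \<subseteq> gens E \<Longrightarrow> set (twist_letters k n gs) \<subseteq> gens E"
  by (induction gs arbitrary: n) (simp_all add: shift_gens)

lemma twist_letters_untwisted: "twist_letters 0 n gs = map (shift n) gs"
  by (induction gs) simp_all

lemma twist_word_add:
  "twist_word k n (u + v) = twist_word k n u + twist_word k (n + k * word_degree u) v"
  by (simp add: twist_word_def plus_word_def twist_letters_append word_degree_def)

lemma twist_word_zero [simp]: "twist_word k n 0 = 0"
  by (simp add: twist_word_def zero_word_def)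

lemma twist_word_eq_zero_iff [simp]: "twist_word k n w = 0 \<longleftrightarrow> w = 0"
  by (cases "letters w") (simp_all add: twist_word_def word_eq_zero_iff)

lemma twist_word_twist_word: "twist_word k n (twist_word l m w) = twist_word (k + l) (n + m) w"
  by (simp add: twist_word_def twist_letters_twist_letters)

lemma twist_word_id: "twist_word 0 0 w = w"
  by (simp add: twist_word_def twist_letters_id)

lemma word_degree_twist_word [simp]: "word_degree (twist_word k n w) = word_degree w"
  by (simp add: twist_word_def word_degree_def degree_twist_letters)

lemma twist_word_gens: "set (letters w) \<subseteq> gens E \<Longrightarrow> set (letters (twist_word k n w)) \<subseteq> gens E"
  by (simp add: twist_word_def twist_letters_gens)

definition twist :: "int \<Rightarrow> int \<Rightarrow> ('v, 'e, 'k::field) free_elem \<Rightarrow> ('v, 'e, 'k) free_elem" where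
  "twist k n = linear_extension (\<lambda>w. Poly_Mapping.single (twist_word k n w) 1)"

lemma twist_zero [simp]: "twist k n 0 = 0"
  by (simp add: twist_def)

lemma twist_add: "twist k n (x + y) = twist k n x + twist k n y"
  by (simp add: twist_def linear_extension_add)

lemma twist_diff: "twist k n (x - y) = twist k n x - twist k n y"
  by (simp add: twist_def linear_extension_diff)

lemma twist_sum: "twist k n (sum f S) = (\<Sum>i\<in>S. twist k n (f i))"
  by (simp add: twist_def linear_extension_sum)

lemma twist_scale: "twist k n (scale c x) = scale c (twist k n x)"
  by (simp add: twist_def scale_def linear_extension_scalar)

lemma twist_single [simp]:
  "twist k n (Poly_Mapping.single w c) = Poly_Mapping.single (twist_word k n w) c"
  by (simp add: twist_def mult_single)

lemma twist_twist: "twist k n (twist l m x) = twist (k + l) (n + m) x"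
  using subset_UNIV[of "Poly_Mapping.keys x"]
  by (induction rule: additive_induct) (simp_all add: twist_add twist_word_twist_word)

lemma twist_id: "twist 0 0 x = x"
  using subset_UNIV[of "Poly_Mapping.keys x"]
  by (induction rule: additive_induct) (simp_all add: twist_add twist_word_id)

lemma keys_twist: "Poly_Mapping.keys (twist k n x) \<subseteq> twist_word k n ` Poly_Mapping.keys x"
  unfolding twist_def by (rule keys_linear_extension_subset) simp

lemma twist_free_alg: "x \<in> free_alg E \<Longrightarrow> twist k n x \<in> free_alg E"
  using keys_twist[of k n x] twist_word_gens[of _ k n] by (fastforce simp: free_alg_def)

lemma homogeneous_twist: "homogeneous d x \<Longrightarrow> homogeneous d (twist k n x)"
  using keys_twist[of k n x] by (fastforce simp: homogeneous_def)

text \<open>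
  A left factor of degree \<open>d\<close> changes the height at which the right factor is read by \<open>k d\<close>.  With
  \<open>twist_twist\<close> this says that \<open>twist (- 1) 0\<close> turns the product \<open>x \<cdot> \<sigma>\<^sup>d(y)\<close> into the ordinary
  product.
\<close>

lemma twist_mult:
  assumes "homogeneous d x"
  shows "twist k n (x * y) = twist k n x * twist k (n + k * d) y"
proof -
  have "Poly_Mapping.keys x \<subseteq> {w. word_degree w = d}"
    using assms by (auto simp: homogeneous_def)
  then show ?thesis
  proof (induction rule: additive_induct)
    case (single u c)
    then have u: "word_degree u = d" by simp
    show ?case
      using subset_UNIV[of "Poly_Mapping.keys y"]
      by (induction rule: additive_induct)
        (simp_all add: distrib_left twist_add mult_single twist_word_add u)
  qed (simp_all add: distrib_right twist_add)
qed

lemma twist_gen: "twist k n (gen_elem g) = gen_elem (shift (n + k * min 0 (gen_degree g)) g)"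
  by (simp add: gen_elem_def twist_word_def)

lemma twist_gen_mult:
  "twist k n (gen_elem g * gen_elem h) = gen_elem (shift (n + k * min 0 (gen_degree g)) g) *
     gen_elem (shift (n + k * gen_degree g + k * min 0 (gen_degree h)) h)"
  by (simp add: twist_mult[OF homogeneous_gen[OF refl]] twist_gen)

text \<open>
  The graph \<open>F\<close> is the twist of \<open>E\<close> by the \<open>k\<close>-th power of the automorphism.  Source and
  range are compared on edges of the graph only, so that the relation can be read in both directions.
\<close>

definition twisted_by :: "int \<Rightarrow> ('v, 'e) pre_digraph \<Rightarrow> bool" where
  "twisted_by k F \<longleftrightarrow> verts F = verts E \<and> arcs F = arcs E \<and>
     (\<forall>e\<in>arcs E. tail F e = tail E e) \<and> (\<forall>e\<in>arcs E. head E e = p k (head F e))"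

text \<open>
  A relator of \<open>F\<close> read at any height becomes a relator of \<open>E\<close>.  The two letters of \<open>e r(e)\<close> are read
  at different heights, which is compensated by the relation between the range maps
  of \<open>E\<close> and \<open>F\<close>; in \<open>e e\<^sup>*\<close> and \<open>e\<^sup>* f\<close> both letters have the same lower height and are shifted
  equally.
\<close>

lemma twist_relator:
  fixes r :: "('v, 'e, 'k::field) free_elem"
  assumes F: "twisted_by k F" and r: "r \<in> lpa_relators F"
  shows "twist k n r \<in> lpa_relators E"
proof -
  have vF: "verts F = verts E" and aF: "arcs F = arcs E"
    and tF: "\<And>e. e \<in> arcs E \<Longrightarrow> tail F e = tail E e"
    \<comment> \<open>Shifting by \<open>m\<close> in \<open>F\<close> is shifting by \<open>m - k\<close> in \<open>E\<close>, as far as ranges of edges are concerned.\<close>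
    and hF: "\<And>e. e \<in> arcs E \<Longrightarrow> p m (head F e) = head E (q (m - k) e)" for m
    using F by (auto simp: twisted_by_def head_q p_add[symmetric])
  have oF: "out_arcs F v = out_arcs E v" for v
    by (auto simp: out_arcs_def aF tF)
  let ?R = "lpa_relators E :: ('v, 'e, 'k) free_elem set"
  have
    1: "v \<in> verts E \<Longrightarrow> w \<in> verts E \<Longrightarrow> vx v * vx w - (if v = w then vx w else 0) \<in> ?R" and
    2: "e \<in> arcs E \<Longrightarrow> vx (tail E e) * ed e - ed e \<in> ?R" and
    3: "e \<in> arcs E \<Longrightarrow> ed e * vx (head E e) - ed e \<in> ?R" and
    4: "e \<in> arcs E \<Longrightarrow> gh e * vx (tail E e) - gh e \<in> ?R" and
    5: "e \<in> arcs E \<Longrightarrow> vx (head E e) * gh e - gh e \<in> ?R" and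
    6: "e \<in> arcs E \<Longrightarrow> f \<in> arcs E \<Longrightarrow> gh e * ed f - (if e = f then vx (head E e) else 0) \<in> ?R" and
    7: "regular_vertex E v \<Longrightarrow> vx v - (\<Sum>e\<in>out_arcs E v. ed e * gh e) \<in> ?R" for v w e f
    unfolding lpa_relators_def by blast+
  note simps = twist_diff twist_gen_mult twist_gen
  from r show ?thesis
    unfolding lpa_relators_def[of F]
  proof (elim UnE CollectE exE conjE)
    fix v w assume "r = vx v * vx w - (if v = w then vx w else 0)" "v \<in> verts F" "w \<in> verts F"
    then show ?thesis
      using 1[of "p n v" "p n w"] by (simp add: simps vF p_verts split: if_splits)
  next
    fix e assume "r = vx (tail F e) * ed e - ed e" "e \<in> arcs F"
    then show ?thesis
      using 2[of "q n e"] by (simp add: simps aF tF tail_q q_arcs)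
  next
    fix e assume "r = ed e * vx (head F e) - ed e" "e \<in> arcs F"
    then show ?thesis
      using 3[of "q n e"] by (simp add: simps aF hF q_arcs)
  next
    fix e assume "r = gh e * vx (tail F e) - gh e" "e \<in> arcs F"
    then show ?thesis
      using 4[of "q (n - k) e"] by (simp add: simps aF tF tail_q q_arcs)
  next
    fix e assume "r = vx (head F e) * gh e - gh e" "e \<in> arcs F"
    then show ?thesis
      using 5[of "q (n - k) e"] by (simp add: simps aF hF q_arcs)
  next
    fix e f assume "r = gh e * ed f - (if e = f then vx (head F e) else 0)" "e \<in> arcs F" "f \<in> arcs F"
    then show ?thesis
      using 6[of "q (n - k) e" "q (n - k) f"] by (simp add: simps aF hF q_arcs split: if_splits)
  next
    fix v assume rv: "r = vx v - (\<Sum>e\<in>out_arcs F v. ed e * gh e)" "regular_vertex F v"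
    have "regular_vertex E (p n v)"
      using rv(2) by (auto simp: regular_vertex_def oF vF p_verts out_arcs_shift)
    moreover have "(\<Sum>e\<in>out_arcs E (p n v). ed e * gh e)
        = (\<Sum>e\<in>out_arcs E v. ed (q n e) * gh (q n e) :: ('v, 'e, 'k) free_elem)"
      unfolding out_arcs_shift by (subst sum.reindex) (auto simp: inj_on_def)
    ultimately show ?thesis
      using 7[of "p n v"] by (simp add: rv(1) simps twist_sum oF)
  qed
qed

lemma twist_ideal:
  assumes F: "twisted_by k F" and "x \<in> lpa_ideal F"
  shows "twist k n x \<in> lpa_ideal E"
  using assms(2)
proof (induction rule: lpa_ideal_induct)
  case (monomial u v c r)
  have gens: "gens F = gens E"
    using F by (simp add: gens_def twisted_by_def)
  obtain d where "homogeneous d r" using relator_homogeneous[OF monomial(1)] .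
  then have "homogeneous (word_degree u + d) (Poly_Mapping.single u c * r)"
    by (intro homogeneous_mult homogeneous_single) simp_all
  then have "twist k n (Poly_Mapping.single u c * r * Poly_Mapping.single v 1)
      = Poly_Mapping.single (twist_word k n u) c * twist k (n + k * word_degree u) r *
        Poly_Mapping.single (twist_word k (n + k * (word_degree u + d)) v) 1"
    by (simp add: twist_mult twist_mult[OF homogeneous_single[OF refl]])
  moreover have "\<dots> \<in> lpa_ideal E"
    by (intro ideal_monomial_right ideal_monomial_left lpa_ideal.relator[OF twist_relator[OF F]]
        twist_word_gens) (use monomial gens in auto)
  ultimately show ?case by simp
qed (simp_all add: twist_add lpa_ideal.add lpa_ideal.zero)

end

section \<open>The isomorphism\<close>

lemma abelian_group_mult_update:
  "abelian_group (L\<lparr>monoid.mult := m\<rparr>) \<longleftrightarrow> abelian_group L"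
  by (simp add: abelian_group_def abelian_monoid_def abelian_group_axioms_def)

lemma homog_decomp_mult_update:
  "homog_decomp (L\<lparr>monoid.mult := m\<rparr>) = homog_decomp L"
  by (simp add: homog_decomp_def finsum_def fun_eq_iff)

lemma submodule_mult_update:
  "submodule H R (L\<lparr>monoid.mult := m\<rparr>) \<longleftrightarrow> submodule H R L"
  by (simp add: submodule_def submodule_axioms_def)

text \<open>
  A graded isomorphism pulls the axioms on the product back from its target, so that for a new
  product on a graded algebra it suffices to exhibit such a map.  Applied to the twist, this
  replaces a direct verification that the twisted product is associative and bilinear.
\<close>

lemma graded_algebra_mult_update:
  fixes L :: "('k::field, 'a) graded_alg" and B :: "('k, 'b) graded_alg"
    and m :: "'a \<Rightarrow> 'a \<Rightarrow> 'a"
  defines "A \<equiv> L\<lparr>monoid.mult := m\<rparr>"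
  assumes L: "graded_algebra L" and B: "graded_algebra B"
    and closed: "\<And>x y. x \<in> carrier L \<Longrightarrow> y \<in> carrier L \<Longrightarrow> m x y \<in> carrier L"
    and iso: "\<phi> \<in> graded_algebra_iso A B"
  shows "graded_algebra A"
proof -
  interpret L: graded_algebra L by (rule L)
  interpret B: graded_algebra B by (rule B)
  have inj: "inj_on \<phi> (carrier A)" and into: "\<And>x. x \<in> carrier A \<Longrightarrow> \<phi> x \<in> carrier B"
    and add: "\<And>x y. x \<in> carrier A \<Longrightarrow> y \<in> carrier A \<Longrightarrow> \<phi> (x \<oplus>\<^bsub>A\<^esub> y) = \<phi> x \<oplus>\<^bsub>B\<^esub> \<phi> y"
    and mult: "\<And>x y. x \<in> carrier A \<Longrightarrow> y \<in> carrier A \<Longrightarrow> \<phi> (x \<otimes>\<^bsub>A\<^esub> y) = \<phi> x \<otimes>\<^bsub>B\<^esub> \<phi> y"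
    and smult: "\<And>c x. x \<in> carrier A \<Longrightarrow> \<phi> (c \<odot>\<^bsub>A\<^esub> x) = c \<odot>\<^bsub>B\<^esub> \<phi> x"
    and homog: "\<And>n. \<phi> ` homog A n = homog B n"
    using iso by (auto simp: graded_algebra_iso_def bij_betw_def)
  have mult_closed: "x \<otimes>\<^bsub>A\<^esub> y \<in> carrier A" and add_closed: "x \<oplus>\<^bsub>A\<^esub> y \<in> carrier A"
    if "x \<in> carrier A" "y \<in> carrier A" for x y
    using that closed by (simp_all add: A_def)
  have smult_closed: "c \<odot>\<^bsub>A\<^esub> x \<in> carrier A" if "x \<in> carrier A" for c x
    using that L.smult_closed[of c x] by (simp add: A_def ring_of_type_algebra_def)
  have homog_carrier: "x \<in> carrier A" if "x \<in> homog A n" for x n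
    using that L.submoduleE(1)[OF L.homog_submodule] by (auto simp: A_def)
  have mod: "module (ring_of_type_algebra :: 'k ring) A"
  proof (rule moduleI)
    show "cring (ring_of_type_algebra :: 'k ring)" by (rule L.R.is_cring)
    show "abelian_group A"
      unfolding A_def abelian_group_mult_update by (rule L.M.abelian_group_axioms)
  qed (simp_all add: A_def L.smult_l_distr L.smult_r_distr L.smult_assoc1)
  note simps = mult_closed add_closed smult_closed into add mult smult
  show ?thesis
  proof (intro graded_algebra.intro mod graded_algebra_axioms.intro)
    fix x y z assume xyz: "x \<in> carrier A" "y \<in> carrier A" "z \<in> carrier A"
    show "(x \<otimes>\<^bsub>A\<^esub> y) \<otimes>\<^bsub>A\<^esub> z = x \<otimes>\<^bsub>A\<^esub> (y \<otimes>\<^bsub>A\<^esub> z)"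
      by (rule inj_onD[OF inj]) (simp_all add: xyz simps B.mult_assoc)
    show "(x \<oplus>\<^bsub>A\<^esub> y) \<otimes>\<^bsub>A\<^esub> z = x \<otimes>\<^bsub>A\<^esub> z \<oplus>\<^bsub>A\<^esub> y \<otimes>\<^bsub>A\<^esub> z"
      by (rule inj_onD[OF inj]) (simp_all add: xyz simps B.mult_add_left)
    show "z \<otimes>\<^bsub>A\<^esub> (x \<oplus>\<^bsub>A\<^esub> y) = z \<otimes>\<^bsub>A\<^esub> x \<oplus>\<^bsub>A\<^esub> z \<otimes>\<^bsub>A\<^esub> y"
      by (rule inj_onD[OF inj]) (simp_all add: xyz simps B.mult_add_right)
  next
    fix x y c assume xy: "x \<in> carrier A" "y \<in> carrier A"
    show "x \<otimes>\<^bsub>A\<^esub> y \<in> carrier A" by (rule mult_closed[OF xy])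
    show "(c \<odot>\<^bsub>A\<^esub> x) \<otimes>\<^bsub>A\<^esub> y = c \<odot>\<^bsub>A\<^esub> (x \<otimes>\<^bsub>A\<^esub> y)"
      by (rule inj_onD[OF inj]) (simp_all add: xy simps B.mult_smult_left)
    show "x \<otimes>\<^bsub>A\<^esub> (c \<odot>\<^bsub>A\<^esub> y) = c \<odot>\<^bsub>A\<^esub> (x \<otimes>\<^bsub>A\<^esub> y)"
      by (rule inj_onD[OF inj]) (simp_all add: xy simps B.mult_smult_right)
  next
    fix n show "submodule (homog A n) (ring_of_type_algebra :: 'k ring) A"
      using L.homog_submodule by (simp add: A_def submodule_mult_update)
  next
    fix a assume "a \<in> carrier A"
    then show "\<exists>!f. homog_decomp A a f"
      using L.homog_direct_sum by (simp add: A_def homog_decomp_mult_update)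
  next
    fix x y i j assume xy: "x \<in> homog A i" "y \<in> homog A j"
    have "\<phi> (x \<otimes>\<^bsub>A\<^esub> y) = \<phi> x \<otimes>\<^bsub>B\<^esub> \<phi> y"
      by (intro mult homog_carrier[OF xy(1)] homog_carrier[OF xy(2)])
    also have "\<dots> \<in> homog B (i + j)"
      by (rule B.homog_mult) (use xy in \<open>simp_all add: homog[symmetric]\<close>)
    finally obtain z where z: "z \<in> homog A (i + j)" "\<phi> (x \<otimes>\<^bsub>A\<^esub> y) = \<phi> z"
      unfolding homog[symmetric] by blast
    have "x \<otimes>\<^bsub>A\<^esub> y = z"
      by (rule inj_onD[OF inj z(2)])
        (intro mult_closed homog_carrier[OF xy(1)] homog_carrier[OF xy(2)] homog_carrier[OF z(1)])+
    then show "x \<otimes>\<^bsub>A\<^esub> y \<in> homog A (i + j)" using z(1) by simp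
  qed
qed

lemma ring_of_unital_iso:
  fixes A :: "('k::field, 'a) graded_alg" and B :: "('k, 'b) graded_alg"
  assumes A: "graded_algebra A" and iso: "\<phi> \<in> graded_algebra_iso A B" and B: "ring B"
    and one: "\<one>\<^bsub>A\<^esub> \<in> carrier A" "\<phi> \<one>\<^bsub>A\<^esub> = \<one>\<^bsub>B\<^esub>"
  shows "ring A" "\<phi> \<in> ring_hom A B"
proof -
  interpret A: graded_algebra A by (rule A)
  interpret B: ring B by (rule B)
  have inj: "inj_on \<phi> (carrier A)" and into: "\<And>x. x \<in> carrier A \<Longrightarrow> \<phi> x \<in> carrier B"
    and add: "\<And>x y. x \<in> carrier A \<Longrightarrow> y \<in> carrier A \<Longrightarrow> \<phi> (x \<oplus>\<^bsub>A\<^esub> y) = \<phi> x \<oplus>\<^bsub>B\<^esub> \<phi> y"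
    and mult: "\<And>x y. x \<in> carrier A \<Longrightarrow> y \<in> carrier A \<Longrightarrow> \<phi> (x \<otimes>\<^bsub>A\<^esub> y) = \<phi> x \<otimes>\<^bsub>B\<^esub> \<phi> y"
    using iso by (auto simp: graded_algebra_iso_def bij_betw_def)
  show "\<phi> \<in> ring_hom A B"
    by (rule ring_hom_memI) (simp_all add: into add mult one)
  show "ring A"
  proof (rule ringI)
    show "abelian_group A" by (rule A.M.abelian_group_axioms)
    show "Group.monoid A"
    proof (rule monoidI)
      fix x assume x: "x \<in> carrier A"
      show "\<one>\<^bsub>A\<^esub> \<otimes>\<^bsub>A\<^esub> x = x"
        by (rule inj_onD[OF inj]) (simp_all add: x one into mult A.mult_closed)
      show "x \<otimes>\<^bsub>A\<^esub> \<one>\<^bsub>A\<^esub> = x"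
        by (rule inj_onD[OF inj]) (simp_all add: x one into mult A.mult_closed)
    qed (simp_all add: one A.mult_closed A.mult_assoc)
  qed (simp_all add: A.mult_add_left A.mult_add_right)
qed

context integer_graph_action
begin

lemma twisted_by_zero: "twisted_by 0 E"
  by (simp add: twisted_by_def)

text \<open>
  Twisting is invertible: the same maps act on the twisted graph, and \<open>E\<close> is its twist by the
  inverse power.  Facts proved for one direction thus serve for both.
\<close>

lemma twisted_action:
  assumes "twisted_by k F"
  shows "integer_graph_action F p q" "integer_graph_action.twisted_by F p (- k) E"
proof -
  have vF: "verts F = verts E" and aF: "arcs F = arcs E"
    and tF: "\<And>e. e \<in> arcs E \<Longrightarrow> tail F e = tail E e"
    and hF: "\<And>e. e \<in> arcs E \<Longrightarrow> head F e = p (- k) (head E e)"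
    using assms by (auto simp: twisted_by_def)
  show F: "integer_graph_action F p q"
  proof unfold_locales
    fix e n assume "e \<in> arcs F"
    then show "head F (q n e) = p n (head F e)"
      by (simp add: aF hF q_arcs head_q p_add[symmetric] add.commute)
  qed (auto simp: vF aF tF hF p_add q_add p_verts q_arcs tail_q)
  show "integer_graph_action.twisted_by F p (- k) E"
    by (simp add: integer_graph_action.twisted_by_def[OF F] vF aF tF hF)
qed

lemma class_twist_cong:
  assumes "twisted_by k F" "x \<in> free_alg E" "y \<in> free_alg E" "x - y \<in> lpa_ideal F"
  shows "lpa_class E (twist k n x) = lpa_class E (twist k n y)"
  using twist_ideal[OF assms(1,4), of n] assms(2,3)
  by (simp add: class_eq_iff twist_free_alg twist_diff)

lemma free_induced_eq_twist:
  assumes "x \<in> free_alg E" "\<And>v. v \<in> verts E \<Longrightarrow> \<sigma>\<^sub>0 v = p 1 v" "\<And>e. e \<in> arcs E \<Longrightarrow> \<sigma>\<^sub>1 e = q 1 e"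
  shows "free_induced \<sigma>\<^sub>0 \<sigma>\<^sub>1 x = twist 0 1 x"
  unfolding free_induced_def twist_def linear_extension_def
proof (rule sum.cong[OF refl])
  fix w assume "w \<in> Poly_Mapping.keys x"
  then have "\<forall>g\<in>set (letters w). g \<in> gens E"
    using assms(1) by (auto simp: free_alg_def)
  then have "map (map_gen \<sigma>\<^sub>0 \<sigma>\<^sub>1) (letters w) = map (shift 1) (letters w)"
    by (auto simp: gens_def assms(2,3))
  then have "map_word (map_gen \<sigma>\<^sub>0 \<sigma>\<^sub>1) w = twist_word 0 1 w"
    by (cases w) (simp add: twist_word_def twist_letters_untwisted)
  then show "Poly_Mapping.single (map_word (map_gen \<sigma>\<^sub>0 \<sigma>\<^sub>1) w) (Poly_Mapping.lookup x w)
      = Poly_Mapping.single 0 (Poly_Mapping.lookup x w) * Poly_Mapping.single (twist_word 0 1 w) 1"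
    by (simp add: mult_single)
qed

text \<open>
  The right-hand side is the twisted product of \<open>x\<close> and \<open>y\<close> at the level of representatives; the
  left-hand side is the product of the free algebra carried over by \<open>twist (- 1) 0\<close>.
\<close>

lemma twist_product:
  "twist 1 0 (twist (- 1) 0 x * twist (- 1) 0 y)
   = (\<Sum>m\<in>word_degree ` Poly_Mapping.keys x. component m x * twist 0 m y)"
proof -
  have "x = (\<Sum>m\<in>word_degree ` Poly_Mapping.keys x. component m x)"
    by (simp add: sum_components)
  then have "twist 1 0 (twist (- 1) 0 x * twist (- 1) 0 y)
      = (\<Sum>m\<in>word_degree ` Poly_Mapping.keys x.
          twist 1 0 (twist (- 1) 0 (component m x) * twist (- 1) 0 y))"
    by (metis (mono_tags, lifting) sum.cong sum_distrib_right twist_sum)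
  also have "\<dots> = (\<Sum>m\<in>word_degree ` Poly_Mapping.keys x. component m x * twist 0 m y)"
    by (intro sum.cong refl)
      (simp add: twist_mult[OF homogeneous_twist[OF homogeneous_component]] twist_twist twist_id)
  finally show ?thesis .
qed

lemma twist_vertex_sum: "twist k 0 (\<Sum>v\<in>verts E. vx v) = (\<Sum>v\<in>verts E. vx v)"
  by (simp add: twist_sum twist_gen)

end

locale twisted_lpa = integer_graph_action E p q
  for E :: "('v, 'e) pre_digraph" and p q +
  fixes \<sigma>\<^sub>0 :: "'v \<Rightarrow> 'v" and \<sigma>\<^sub>1 :: "'e \<Rightarrow> 'e" and F :: "('v, 'e) pre_digraph"
    and L :: "('k::field, ('v, 'e, 'k) free_elem set) graded_alg"
    and A :: "('k, ('v, 'e, 'k) free_elem set) graded_alg"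
    and B :: "('k, ('v, 'e, 'k) free_elem set) graded_alg"
  assumes \<sigma>\<^sub>0: "\<And>v. v \<in> verts E \<Longrightarrow> \<sigma>\<^sub>0 v = p 1 v" and \<sigma>\<^sub>1: "\<And>e. e \<in> arcs E \<Longrightarrow> \<sigma>\<^sub>1 e = q 1 e"
    and F: "twisted_by 1 F"
  defines L_def: "L \<equiv> leavitt_path_algebra TYPE('k) E"
    and A_def: "A \<equiv> zhang_twist L (lpa_induced E \<sigma>\<^sub>0 \<sigma>\<^sub>1)"
    and B_def: "B \<equiv> leavitt_path_algebra TYPE('k) F"
begin

sublocale F: integer_graph_action F p q
  by (rule twisted_action(1)[OF F])

lemma E_twisted: "F.twisted_by (- 1) E"
  using twisted_action(2)[OF F] .

lemma free_alg_F: "free_alg F = free_alg E"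
  using F by (simp add: free_alg_def gens_def twisted_by_def)

lemma free_homog_F: "free_homog F n = free_homog E n"
  by (simp add: free_homog_def free_alg_F)

lemmas L_simps = lpa_class_simps[where 'k = 'k and E = E, folded L_def]
lemmas B_simps = lpa_class_simps[where 'k = 'k and E = F, folded B_def, unfolded free_alg_F free_homog_F]

abbreviation h where "h \<equiv> lpa_induced E \<sigma>\<^sub>0 \<sigma>\<^sub>1"

lemma induced_class:
  fixes x :: "('v, 'e, 'k) free_elem"
  assumes "x \<in> free_alg E"
  shows "h (lpa_class E x) = lpa_class E (twist 0 1 x)"
  unfolding lpa_induced_def
proof (subst UN_class[where f = "\<lambda>x. lpa_class E (free_induced \<sigma>\<^sub>0 \<sigma>\<^sub>1 x)"])
  fix x y :: "('v, 'e, 'k) free_elem"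
  assume "x \<in> free_alg E" "y \<in> free_alg E" "x - y \<in> lpa_ideal E"
  then show "lpa_class E (free_induced \<sigma>\<^sub>0 \<sigma>\<^sub>1 x) = lpa_class E (free_induced \<sigma>\<^sub>0 \<sigma>\<^sub>1 y)"
    using class_twist_cong[OF twisted_by_zero] by (simp add: free_induced_eq_twist \<sigma>\<^sub>0 \<sigma>\<^sub>1)
qed (simp_all add: assms free_induced_eq_twist \<sigma>\<^sub>0 \<sigma>\<^sub>1)

lemma inv_induced_class:
  fixes x :: "('v, 'e, 'k) free_elem"
  assumes "x \<in> free_alg E"
  shows "inv_into (carrier L) h (lpa_class E x) = lpa_class E (twist 0 (- 1) x)"
proof (rule inv_into_f_eq)
  show "inj_on h (carrier L)"
  proof (rule inj_onI)
    fix P Q assume "P \<in> carrier L" "Q \<in> carrier L" and eq: "h P = h Q"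
    then obtain y z where yz: "P = lpa_class E y" "Q = lpa_class E z" "y \<in> free_alg E" "z \<in> free_alg E"
      by (auto simp: L_simps)
    have "twist 0 1 y - twist 0 1 z \<in> lpa_ideal E"
      using eq yz by (simp add: induced_class class_eq_iff twist_free_alg)
    then have "twist 0 (- 1) (twist 0 1 y - twist 0 1 z) \<in> lpa_ideal E"
      by (rule twist_ideal[OF twisted_by_zero])
    then show "P = Q"
      using yz by (simp add: class_eq_iff twist_diff twist_twist twist_id)
  qed
qed (use assms in \<open>simp_all add: L_simps induced_class twist_free_alg twist_twist twist_id\<close>)

lemma aut_power_class:
  fixes x :: "('v, 'e, 'k) free_elem"
  assumes "x \<in> free_alg E"
  shows "aut_power L h m (lpa_class E x) = lpa_class E (twist 0 m x)"
proof -
  have pos: "(h ^^ n) (lpa_class E x) = lpa_class E (twist 0 (int n) x)" for n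
    by (induction n) (simp_all add: assms twist_id induced_class twist_free_alg twist_twist)
  have neg: "(inv_into (carrier L) h ^^ n) (lpa_class E x) = lpa_class E (twist 0 (- int n) x)" for n
    by (induction n) (simp_all add: assms twist_id inv_induced_class twist_free_alg twist_twist)
  show ?thesis
    by (simp add: aut_power_def pos neg)
qed

lemma A_simps [simp]:
  "carrier A = carrier L" "\<zero>\<^bsub>A\<^esub> = \<zero>\<^bsub>L\<^esub>" "\<one>\<^bsub>A\<^esub> = \<one>\<^bsub>L\<^esub>" "x \<oplus>\<^bsub>A\<^esub> y = x \<oplus>\<^bsub>L\<^esub> y"
  "c \<odot>\<^bsub>A\<^esub> x = c \<odot>\<^bsub>L\<^esub> x" "homog A n = homog L n"
  by (simp_all add: A_def zhang_twist_def)

lemma A_mult: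
  assumes x: "x \<in> free_alg E" and y: "y \<in> free_alg E"
  shows "lpa_class E x \<otimes>\<^bsub>A\<^esub> lpa_class E y
    = lpa_class E (twist 1 0 (twist (- 1) 0 x * twist (- 1) 0 y))"
proof -
  interpret abelian_group L unfolding L_def by (rule abelian_group_lpa)
  let ?D = "word_degree ` Poly_Mapping.keys x"
  let ?hp = "homog_part L (lpa_class E x)"
  let ?g = "\<lambda>m. component m x * twist 0 m y"
  have hp: "?hp m = lpa_class E (component m x)" for m
    unfolding L_def by (rule homog_part_lpa[OF x])
  have summand: "?hp m \<otimes>\<^bsub>L\<^esub> aut_power L h m (lpa_class E y) = lpa_class E (?g m)" for m
    by (simp add: hp aut_power_class y x L_simps free_alg_component twist_free_alg)
  have "lpa_class E x \<otimes>\<^bsub>A\<^esub> lpa_class E y = finsum L (\<lambda>m. lpa_class E (?g m)) {m. ?hp m \<noteq> \<zero>\<^bsub>L\<^esub>}"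
    by (simp add: A_def zhang_twist_def summand)
  also have "\<dots> = finsum L (\<lambda>m. lpa_class E (?g m)) ?D"
  proof (rule add.finprod_mono_neutral_cong_left)
    show "{m. ?hp m \<noteq> \<zero>\<^bsub>L\<^esub>} \<subseteq> ?D"
      using component_eq_zero by (fastforce simp: hp L_simps)
    show "lpa_class E (?g m) = \<zero>\<^bsub>L\<^esub>" if "m \<in> ?D - {m. ?hp m \<noteq> \<zero>\<^bsub>L\<^esub>}" for m
    proof -
      have "?hp m = lpa_class E 0" using that by (simp add: L_simps)
      then have "lpa_class E (?g m) = lpa_class E 0 \<otimes>\<^bsub>L\<^esub> lpa_class E (twist 0 m y)"
        using y by (simp only: summand[symmetric] aut_power_class)
      then show ?thesis using y by (simp add: L_simps twist_free_alg)
    qed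
  qed (simp_all add: L_simps x y free_alg_mult free_alg_component twist_free_alg)
  also have "\<dots> = lpa_class E (sum ?g ?D)"
    unfolding L_def by (rule lpa_finsum) (simp_all add: x y free_alg_mult free_alg_component twist_free_alg)
  finally show ?thesis by (simp only: twist_product)
qed

definition untwist :: "('v, 'e, 'k) free_elem set \<Rightarrow> ('v, 'e, 'k) free_elem set" where
  "untwist P = (\<Union>x\<in>P. lpa_class F (twist (- 1) 0 x))"

lemma untwist_class:
  assumes "x \<in> free_alg E"
  shows "untwist (lpa_class E x) = lpa_class F (twist (- 1) 0 x)"
  unfolding untwist_def
  by (rule UN_class[OF F.class_twist_cong[OF E_twisted]]) (simp_all add: free_alg_F assms)

lemma untwist_bij: "bij_betw untwist (carrier A) (carrier B)"
proof (rule bij_betwI')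
  fix P Q assume "P \<in> carrier A" "Q \<in> carrier A"
  then obtain x y where xy: "P = lpa_class E x" "Q = lpa_class E y" "x \<in> free_alg E" "y \<in> free_alg E"
    by (auto simp: L_simps)
  have "twist (- 1) 0 (x - y) \<in> lpa_ideal F \<longleftrightarrow> x - y \<in> lpa_ideal E"
  proof
    assume "twist (- 1) 0 (x - y) \<in> lpa_ideal F"
    from twist_ideal[OF F this, of 0] show "x - y \<in> lpa_ideal E"
      by (simp add: twist_twist twist_id)
  qed (rule F.twist_ideal[OF E_twisted])
  then show "untwist P = untwist Q \<longleftrightarrow> P = Q"
    using xy by (simp add: untwist_class class_eq_iff free_alg_F twist_free_alg twist_diff)
next
  fix P assume "P \<in> carrier A"
  then show "untwist P \<in> carrier B"
    by (auto simp: L_simps B_simps untwist_class twist_free_alg)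
next
  fix P assume "P \<in> carrier B"
  then obtain y where y: "P = lpa_class F y" "y \<in> free_alg E"
    by (auto simp: B_simps)
  then have "P = untwist (lpa_class E (twist 1 0 y))" "lpa_class E (twist 1 0 y) \<in> carrier A"
    by (simp_all add: untwist_class twist_free_alg twist_twist twist_id L_simps)
  then show "\<exists>Q\<in>carrier A. P = untwist Q" by blast
qed

lemma untwist_homog: "untwist ` homog A n = homog B n"
proof (intro equalityI subsetI)
  fix P assume "P \<in> untwist ` homog A n"
  then show "P \<in> homog B n"
    by (auto simp: L_simps B_simps untwist_class free_homog_iff twist_free_alg homogeneous_twist)
next
  fix P assume "P \<in> homog B n"
  then obtain y where y: "P = lpa_class F y" "y \<in> free_alg E" "homogeneous n y"
    by (auto simp: B_simps free_homog_iff)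
  then have "P = untwist (lpa_class E (twist 1 0 y))" "lpa_class E (twist 1 0 y) \<in> homog A n"
    by (simp_all add: untwist_class twist_free_alg twist_twist twist_id L_simps free_homog_iff homogeneous_twist)
  then show "P \<in> untwist ` homog A n" by blast
qed

lemma untwist_iso: "untwist \<in> graded_algebra_iso A B"
  unfolding graded_algebra_iso_def
proof (intro CollectI conjI ballI allI untwist_bij untwist_homog)
  fix P Q c assume "P \<in> carrier A"
  then obtain x where x: "P = lpa_class E x" "x \<in> free_alg E"
    by (auto simp: L_simps)
  then show "untwist (c \<odot>\<^bsub>A\<^esub> P) = c \<odot>\<^bsub>B\<^esub> untwist P"
    by (simp add: L_simps B_simps untwist_class free_alg_scale twist_free_alg twist_scale)
  assume "Q \<in> carrier A"
  then obtain y where y: "Q = lpa_class E y" "y \<in> free_alg E"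
    by (auto simp: L_simps)
  show "untwist (P \<oplus>\<^bsub>A\<^esub> Q) = untwist P \<oplus>\<^bsub>B\<^esub> untwist Q"
    by (simp add: x y L_simps B_simps untwist_class free_alg_add twist_free_alg twist_add)
  show "untwist (P \<otimes>\<^bsub>A\<^esub> Q) = untwist P \<otimes>\<^bsub>B\<^esub> untwist Q"
    by (simp add: x y A_mult B_simps untwist_class free_alg_mult twist_free_alg twist_twist twist_id)
qed

lemma graded_algebra_A: "graded_algebra A"
proof -
  have "P \<otimes>\<^bsub>A\<^esub> Q \<in> carrier L" if "P \<in> carrier L" "Q \<in> carrier L" for P Q
    using that by (auto simp: L_simps A_mult free_alg_mult twist_free_alg)
  moreover have "graded_algebra L" "graded_algebra B"
    unfolding L_def B_def by (rule graded_algebra_lpa)+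
  moreover have A: "A = L\<lparr>monoid.mult := \<lambda>P Q. P \<otimes>\<^bsub>A\<^esub> Q\<rparr>"
    by (simp add: A_def zhang_twist_def)
  ultimately show ?thesis
    using graded_algebra_mult_update[of L B "\<lambda>P Q. P \<otimes>\<^bsub>A\<^esub> Q" untwist] untwist_iso by metis
qed

lemma untwist_one: "\<one>\<^bsub>A\<^esub> \<in> carrier A" "untwist \<one>\<^bsub>A\<^esub> = \<one>\<^bsub>B\<^esub>"
proof -
  have one: "\<one>\<^bsub>L\<^esub> = lpa_class E (\<Sum>v\<in>verts E. vx v)" "\<one>\<^bsub>B\<^esub> = lpa_class F (\<Sum>v\<in>verts F. vx v)"
    by (simp_all add: L_def B_def lpa_one)
  have "verts F = verts E" using F by (simp add: twisted_by_def)
  then show "\<one>\<^bsub>A\<^esub> \<in> carrier A" "untwist \<one>\<^bsub>A\<^esub> = \<one>\<^bsub>B\<^esub>"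
    by (simp_all add: one L_simps untwist_class vertex_sum_free twist_vertex_sum)
qed

lemma twisted_lpa_iso:
  "graded_algebra A \<and> graded_algebra B \<and>
   (\<exists>\<phi> \<in> graded_algebra_iso A B.
      finite (verts E) \<longrightarrow> ring A \<and> ring B \<and> \<phi> \<in> ring_hom A B)"
proof (intro conjI bexI[OF _ untwist_iso] impI graded_algebra_A)
  show "graded_algebra B"
    unfolding B_def by (rule graded_algebra_lpa)
  assume "finite (verts E)"
  then have "finite (verts F)"
    using F by (simp add: twisted_by_def)
  then show B: "ring B"
    unfolding B_def by (rule ring_lpa[OF F.wf_digraph_axioms])
  show "ring A" "untwist \<in> ring_hom A B"
    using ring_of_unital_iso[OF graded_algebra_A untwist_iso B untwist_one] by blast+
qed

end


section \<open>Integer powers of a graph automorphism\<close>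

text \<open>
  Outside \<open>S\<close> the powers are continued by the identity, which makes the group law hold
  everywhere.
\<close>

lemma integer_powers:
  assumes "bij_betw f S S"
  obtains p :: "int \<Rightarrow> 'a \<Rightarrow> 'a" where
    "\<And>x. p 0 x = x" "\<And>m n x. p (m + n) x = p m (p n x)"
    "\<And>n x. x \<in> S \<Longrightarrow> p n x \<in> S" "\<And>x. x \<in> S \<Longrightarrow> p 1 x = f x"
proof -
  interpret group "BijGroup S" by (rule group_BijGroup)
  have carrier: "carrier (BijGroup S) = Bij S"
    and one: "\<one>\<^bsub>BijGroup S\<^esub> = (\<lambda>x\<in>S. x)"
    and mult: "\<And>g h. g \<in> Bij S \<Longrightarrow> h \<in> Bij S \<Longrightarrow> g \<otimes>\<^bsub>BijGroup S\<^esub> h = compose S g h"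
    by (simp_all add: BijGroup_def)
  define g where "g = restrict f S"
  define P where "P n = g [^]\<^bsub>BijGroup S\<^esub> n" for n :: int
  define p where "p n x = (if x \<in> S then P n x else x)" for n x
  have g: "g \<in> carrier (BijGroup S)"
    using assms by (simp add: g_def carrier Bij_def)
  have P_Bij: "P n \<in> Bij S" for n
    using int_pow_closed[OF g, of n] by (simp only: P_def carrier)
  have into: "P n x \<in> S" if "x \<in> S" for n x
    by (rule funcset_mem[OF Bij_imp_funcset[OF P_Bij] that])
  have P_add: "P (m + n) = compose S (P m) (P n)" for m n
    using int_pow_mult[OF g, of m n] by (simp only: P_def[symmetric] mult[OF P_Bij P_Bij])
  have P_simps: "P 0 = (\<lambda>x\<in>S. x)" "P 1 = g"
    using int_pow_1[OF g] by (simp_all only: P_def int_pow_0 one)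
  show thesis
  proof (rule that[of p])
    show "p (m + n) x = p m (p n x)" for m n x
      by (simp add: p_def P_add into compose_def)
    show "p 0 x = x" for x
      by (simp add: p_def P_simps)
    show "p n x \<in> S" if "x \<in> S" for n x
      using that by (simp add: p_def into)
    show "p 1 x = f x" if "x \<in> S" for x
      using that by (simp add: p_def P_simps g_def)
  qed
qed

text \<open>
  Equivariance passes from the generator \<open>1\<close> to all integers, for negative ones by cancelling the
  invertible map \<open>p 1\<close>.
\<close>

lemma equivariant_powers:
  fixes p :: "int \<Rightarrow> 'a \<Rightarrow> 'a" and q :: "int \<Rightarrow> 'b \<Rightarrow> 'b"
  assumes p: "\<And>x. p 0 x = x" "\<And>m n x. p (m + n) x = p m (p n x)"
    and q: "\<And>x. q 0 x = x" "\<And>m n x. q (m + n) x = q m (q n x)" "\<And>n x. x \<in> S \<Longrightarrow> q n x \<in> S"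
    and t: "\<And>x. x \<in> S \<Longrightarrow> t (q 1 x) = p 1 (t x)"
    and x: "x \<in> S"
  shows "t (q n x) = p n (t x)"
proof (induction n rule: int_induct[of _ 0])
  case (step1 n)
  have "t (q (1 + n) x) = p (1 + n) (t x)"
    unfolding p q t[OF q(3)[OF x]] step1 ..
  then show ?case by (simp add: add.commute)
next
  case (step2 n)
  have "p 1 (t (q (n - 1) x)) = t (q n x)"
    using q(2)[of 1 "n - 1" x] t[OF q(3)[OF x]] by simp
  also have "\<dots> = p 1 (p (n - 1) (t x))"
    using p(2)[of 1 "n - 1" "t x"] step2 by simp
  finally have "p (- 1) (p 1 (t (q (n - 1) x))) = p (- 1) (p 1 (p (n - 1) (t x)))"
    by simp
  then show ?case
    unfolding p(2)[symmetric] by (simp add: p(1))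
qed (simp add: p q)


section \<open>Leavitt path algebras of twisted graphs\<close>

theorem theorem2p9:
  fixes E :: "('v, 'e) pre_digraph"
    and \<sigma>\<^sub>0 :: "'v \<Rightarrow> 'v" and \<sigma>\<^sub>1 :: "'e \<Rightarrow> 'e"
  assumes "wf_digraph E"
    and "graph_automorphism E \<sigma>\<^sub>0 \<sigma>\<^sub>1"
  shows "let A = zhang_twist (leavitt_path_algebra TYPE('k::field) E) (lpa_induced E \<sigma>\<^sub>0 \<sigma>\<^sub>1);
             B = leavitt_path_algebra TYPE('k) (twisted_graph E \<sigma>\<^sub>0)
         in graded_algebra A \<and> graded_algebra B \<and>
            (\<exists>\<phi> \<in> graded_algebra_iso A B.
               finite (verts E) \<longrightarrow> ring A \<and> ring B \<and> \<phi> \<in> ring_hom A B)"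
proof -
  interpret wf_digraph E by (rule assms(1))
  have bij: "bij_betw \<sigma>\<^sub>0 (verts E) (verts E)" "bij_betw \<sigma>\<^sub>1 (arcs E) (arcs E)"
    and tail: "\<And>e. e \<in> arcs E \<Longrightarrow> tail E (\<sigma>\<^sub>1 e) = \<sigma>\<^sub>0 (tail E e)"
    and head: "\<And>e. e \<in> arcs E \<Longrightarrow> head E (\<sigma>\<^sub>1 e) = \<sigma>\<^sub>0 (head E e)"
    using assms(2) by (auto simp: graph_automorphism_def)
  obtain p :: "int \<Rightarrow> 'v \<Rightarrow> 'v" where p: "\<And>x. p 0 x = x" "\<And>m n x. p (m + n) x = p m (p n x)"
    "\<And>n x. x \<in> verts E \<Longrightarrow> p n x \<in> verts E" "\<And>x. x \<in> verts E \<Longrightarrow> p 1 x = \<sigma>\<^sub>0 x"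
    using integer_powers[OF bij(1)] by blast
  obtain q :: "int \<Rightarrow> 'e \<Rightarrow> 'e" where q: "\<And>x. q 0 x = x" "\<And>m n x. q (m + n) x = q m (q n x)"
    "\<And>n x. x \<in> arcs E \<Longrightarrow> q n x \<in> arcs E" "\<And>x. x \<in> arcs E \<Longrightarrow> q 1 x = \<sigma>\<^sub>1 x"
    using integer_powers[OF bij(2)] by blast
  interpret integer_graph_action E p q
  proof unfold_locales
    fix e n assume e: "e \<in> arcs E"
    show "tail E (q n e) = p n (tail E e)"
      by (rule equivariant_powers[where S = "arcs E", OF p(1,2) q(1-3)])
        (simp_all add: e q(4) p(4) tail)
    show "head E (q n e) = p n (head E e)"
      by (rule equivariant_powers[where S = "arcs E", OF p(1,2) q(1-3)])
        (simp_all add: e q(4) p(4) head)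
  qed (rule p(1,2) q(1,2) | erule p(3) q(3))+
  have "twisted_by 1 (twisted_graph E \<sigma>\<^sub>0)"
  proof -
    have "p 1 (inv_into (verts E) \<sigma>\<^sub>0 (head E e)) = head E e" if "e \<in> arcs E" for e
      using that bij(1) by (simp add: p(4) inv_into_into f_inv_into_f bij_betw_def)
    then show ?thesis
      by (simp add: twisted_by_def twisted_graph_def)
  qed
  then interpret twisted_lpa E p q \<sigma>\<^sub>0 \<sigma>\<^sub>1 "twisted_graph E \<sigma>\<^sub>0"
    "leavitt_path_algebra TYPE('k) E"
    "zhang_twist (leavitt_path_algebra TYPE('k) E) (lpa_induced E \<sigma>\<^sub>0 \<sigma>\<^sub>1)"
    "leavitt_path_algebra TYPE('k) (twisted_graph E \<sigma>\<^sub>0)"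
    by unfold_locales (simp_all only: p(4) q(4))
  show ?thesis
    unfolding Let_def by (rule twisted_lpa_iso)
qed

end
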